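(* The decision problem Static$(\mathcal{X}_d,\mathcal{U}_c(x))$ is undecidable.
   Context: An instance of Static consists of rational data encoded in binary: vectors $a\in\mathbb{Q}^{m_x}$, $b\in\mathbb{Q}^{m_u}$, a matrix $A\in\mathbb{Q}^{m_x\times n_x}$, an $m_u\times n_u$ matrix $B(x)$ whose entries depend linearly on $x$ with rational coefficients, and matrices $H_\ell\in\mathbb{Q}^{n_u\times n_x}$ for $\ell\in[L]=\{1,\dots,L\}$. (Affine dependence can be modelled by auxiliary coordinates of $x$ and $u$ fixed to $1$.) Let $\mathcal{X}_d=\{x\in\mathbb{R}_+^{n_x}: Ax\le a\}\cap\mathbb{Z}^{n_x}$ and $\mathcal{U}_c(x)=\{u\in\mathbb{R}_+^{n_u}: B(x)u\le b\}$ (these sets may be unbounded). Static$(\mathcal{X}_d,\mathcal{U}_c(x))$ is the decision problem $$\exists x\in\mathcal{X}_d\ \ \forall u\in\mathcal{U}_c(x):\ u^\top H_\ell x\le 0\ \text{ for all }\ell\in[L]\,?$$ *)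

theory Defs
  imports "Jordan_Normal_Form.Matrix"
begin

section \<open>Turing machines and decidable languages\<close>

datatype move = Move_Left | Move_Right

text \<open>
  Deterministic machines with one two-way infinite tape. States and tape symbols are initial
  segments of the natural numbers; the initial, accepting and rejecting states are 0, 1 and 2.
  Symbol 0 is the blank, and 1 and 2 stand for the input letters False and True. Further states
  and tape symbols are allowed. Only the values of \<open>tm_trans\<close> on actual states and
  symbols matter, so that a machine is a finite object.
\<close>

record tm =
  tm_states :: nat
  tm_symbols :: nat
  tm_trans :: "nat \<Rightarrow> nat \<Rightarrow> nat \<times> nat \<times> move"

definition turing_machine :: "tm \<Rightarrow> bool" where
  "turing_machine M \<longleftrightarrow> 3 \<le> tm_states M \<and> 3 \<le> tm_symbols M \<and>
     (\<forall>q < tm_states M. \<forall>s < tm_symbols M. \<forall>q' s' d.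
        tm_trans M q s = (q', s', d) \<longrightarrow> q' < tm_states M \<and> s' < tm_symbols M)"

text \<open>A configuration consists of the state, the tape contents and the head position.\<close>

type_synonym config = "nat \<times> (int \<Rightarrow> nat) \<times> int"

fun tm_step :: "tm \<Rightarrow> config \<Rightarrow> config" where
  "tm_step M (q, tape, h) =
     (if q = 1 \<or> q = 2 then (q, tape, h)
      else case tm_trans M q (tape h) of (q', s', d) \<Rightarrow>
        (q', tape(h := s'), case d of Move_Left \<Rightarrow> h - 1 | Move_Right \<Rightarrow> h + 1))"

definition tm_init :: "bool list \<Rightarrow> config" where
  "tm_init w =
     (0, \<lambda>i. if 0 \<le> i \<and> nat i < length w then (if w ! nat i then 2 else 1) else 0, 0)"

definition tm_accepts :: "tm \<Rightarrow> bool list \<Rightarrow> bool" where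
  "tm_accepts M w \<longleftrightarrow> (\<exists>t. fst ((tm_step M ^^ t) (tm_init w)) = 1)"

definition tm_rejects :: "tm \<Rightarrow> bool list \<Rightarrow> bool" where
  "tm_rejects M w \<longleftrightarrow> (\<exists>t. fst ((tm_step M ^^ t) (tm_init w)) = 2)"

definition decidable :: "bool list set \<Rightarrow> bool" where
  "decidable X \<longleftrightarrow> (\<exists>M. turing_machine M \<and>
     (\<forall>w. (w \<in> X \<longrightarrow> tm_accepts M w) \<and> (w \<notin> X \<longrightarrow> tm_rejects M w)))"


section \<open>Instances of Static\<close>

text \<open>
  The matrix $B(x)$ is given by its coefficient matrices: $B(x) = \sum_k x_k B_k$, where $B_k$
  is the \<open>k\<close>-th element of \<open>mats_B\<close>. The numbers of rows $m_x$ and $m_u$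
  are the dimensions of $a$ and $b$.
\<close>

record static_data =
  dim_x :: nat
  dim_u :: nat
  vec_a :: "rat vec"
  vec_b :: "rat vec"
  mat_A :: "rat mat"
  mats_B :: "rat mat list"
  mats_H :: "rat mat list"

definition static_instance :: "static_data \<Rightarrow> bool" where
  "static_instance I \<longleftrightarrow>
     mat_A I \<in> carrier_mat (dim_vec (vec_a I)) (dim_x I) \<and>
     length (mats_B I) = dim_x I \<and>
     set (mats_B I) \<subseteq> carrier_mat (dim_vec (vec_b I)) (dim_u I) \<and>
     set (mats_H I) \<subseteq> carrier_mat (dim_u I) (dim_x I)"

abbreviation real_vec :: "rat vec \<Rightarrow> real vec" where
  "real_vec \<equiv> map_vec of_rat"

abbreviation real_mat :: "rat mat \<Rightarrow> real mat" where
  "real_mat \<equiv> map_mat of_rat"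

definition B_of :: "static_data \<Rightarrow> real vec \<Rightarrow> real mat" where
  "B_of I x = mat (dim_vec (vec_b I)) (dim_u I)
     (\<lambda>(i, j). \<Sum>k < dim_x I. of_rat (mats_B I ! k $$ (i, j)) * x $ k)"

definition X_d :: "static_data \<Rightarrow> real vec set" where
  "X_d I = {x \<in> carrier_vec (dim_x I).
     0\<^sub>v (dim_x I) \<le> x \<and> real_mat (mat_A I) *\<^sub>v x \<le> real_vec (vec_a I) \<and>
     (\<forall>i < dim_x I. x $ i \<in> \<int>)}"

definition U_c :: "static_data \<Rightarrow> real vec \<Rightarrow> real vec set" where
  "U_c I x = {u \<in> carrier_vec (dim_u I).
     0\<^sub>v (dim_u I) \<le> u \<and> B_of I x *\<^sub>v u \<le> real_vec (vec_b I)}"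

definition static :: "static_data \<Rightarrow> bool" where
  "static I \<longleftrightarrow>
     (\<exists>x \<in> X_d I. \<forall>u \<in> U_c I x. \<forall>H \<in> set (mats_H I). u \<bullet> (real_mat H *\<^sub>v x) \<le> 0)"


section \<open>Binary encoding of instances\<close>

text \<open>Binary digits, most significant first; 0 has the empty digit string.\<close>

fun binary :: "nat \<Rightarrow> bool list" where
  "binary n = (if n = 0 then [] else binary (n div 2) @ [odd n])"

declare binary.simps [simp del]

text \<open>
  Every digit is preceded by True and the end of a number is marked by False, which makes the
  code self-delimiting and only doubles its length.
\<close>

definition enc_nat :: "nat \<Rightarrow> bool list" where
  "enc_nat n = concat (map (\<lambda>d. [True, d]) (binary n)) @ [False]"

definition enc_int :: "int \<Rightarrow> bool list" where
  "enc_int z = (z < 0) # enc_nat (nat \<bar>z\<bar>)"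

definition enc_rat :: "rat \<Rightarrow> bool list" where
  "enc_rat r = (case quotient_of r of (p, q) \<Rightarrow> enc_int p @ enc_nat (nat q))"

definition mat_entries :: "'a mat \<Rightarrow> 'a list" where
  "mat_entries M = concat (map list_of_vec (rows M))"

definition static_entries :: "static_data \<Rightarrow> rat list" where
  "static_entries I = list_of_vec (vec_a I) @ list_of_vec (vec_b I) @ mat_entries (mat_A I) @
     concat (map mat_entries (mats_B I)) @ concat (map mat_entries (mats_H I))"

definition encode :: "static_data \<Rightarrow> bool list" where
  "encode I =
     enc_nat (dim_x I) @ enc_nat (dim_u I) @ enc_nat (dim_vec (vec_a I)) @
     enc_nat (dim_vec (vec_b I)) @ enc_nat (length (mats_H I)) @
     concat (map enc_rat (static_entries I))"

definition static_language :: "bool list set" where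
  "static_language = {encode I | I. static_instance I \<and> static I}"


subsection \<open>The encoding is injective\<close>

lemma binary_inj: "binary m = binary n \<Longrightarrow> m = n"
proof (induction m arbitrary: n rule: less_induct)
  case (less m)
  show ?case
  proof (cases "m = 0 \<or> n = 0")
    case True
    then show ?thesis
      using less.prems by (auto simp: binary.simps[of m] binary.simps[of n] split: if_splits)
  next
    case False
    then have "binary (m div 2) = binary (n div 2)" and p: "odd m = odd n"
      using less.prems by (auto simp: binary.simps[of m] binary.simps[of n])
    then have "m div 2 = n div 2"
      using less.IH[of "m div 2" "n div 2"] False by simp
    with p show ?thesis
      by (metis bit_eq_rec)
  qed
qed

lemma marked_digits_eq:
  "concat (map (\<lambda>d. [True, d]) ds) @ False # xs = concat (map (\<lambda>d. [True, d]) es) @ False # ys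
     \<longleftrightarrow> ds = es \<and> xs = ys"
proof (induction ds arbitrary: es)
  case Nil
  then show ?case by (cases es) auto
next
  case (Cons d ds)
  then show ?case by (cases es) auto
qed

lemma enc_nat_append_eq: "enc_nat m @ xs = enc_nat n @ ys \<longleftrightarrow> m = n \<and> xs = ys"
  by (auto simp: enc_nat_def marked_digits_eq dest: binary_inj)

lemma enc_int_append_eq: "enc_int m @ xs = enc_int n @ ys \<longleftrightarrow> m = n \<and> xs = ys"
  by (auto simp: enc_int_def enc_nat_append_eq)

lemma enc_rat_append_eq: "enc_rat r @ xs = enc_rat s @ ys \<longleftrightarrow> r = s \<and> xs = ys"
proof -
  obtain p q p' q' where r: "quotient_of r = (p, q)" and s: "quotient_of s = (p', q')"
    by fastforce
  moreover have "q > 0" "q' > 0"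
    using quotient_of_denom_pos r s by blast+
  moreover have "r = s \<longleftrightarrow> p = p' \<and> q = q'"
    using quotient_of_inject_eq[of r s] r s by simp
  ultimately show ?thesis
    by (auto simp: enc_rat_def enc_int_append_eq enc_nat_append_eq)
qed

lemma concat_enc_rat_inj: "concat (map enc_rat rs) = concat (map enc_rat ss) \<Longrightarrow> rs = ss"
proof (induction rs arbitrary: ss)
  case Nil
  then show ?case
    by (cases ss) (auto simp: enc_rat_def enc_int_def split: prod.splits)
next
  case (Cons r rs)
  then show ?case
    by (cases ss) (auto simp: enc_rat_append_eq, auto simp: enc_rat_def enc_int_def split: prod.splits)
qed

lemma list_of_vec_inj: "list_of_vec v = list_of_vec w \<Longrightarrow> v = w"
  by (metis vec_list)

lemma concat_inj:
  assumes "concat xs = concat ys" and "length xs = length ys"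
    and "\<forall>x \<in> set xs. length x = n" and "\<forall>y \<in> set ys. length y = n"
  shows "xs = ys"
  using assms(2,1,3,4) by (induction xs ys rule: list_induct2) auto

lemma length_mat_entries: "M \<in> carrier_mat m n \<Longrightarrow> length (mat_entries M) = m * n"
proof -
  assume M: "M \<in> carrier_mat m n"
  then have "map length (map list_of_vec (rows M)) = replicate m n"
    by (auto intro!: nth_equalityI)
  then show ?thesis
    unfolding mat_entries_def length_concat by (simp add: sum_list_replicate)
qed

lemma mat_entries_inj:
  assumes "M \<in> carrier_mat m n" "N \<in> carrier_mat m n" "mat_entries M = mat_entries N"
  shows "M = N"
proof -
  have "map list_of_vec (rows M) = map list_of_vec (rows N)"
    using assms by (intro concat_inj[of _ _ n]) (auto simp: mat_entries_def rows_def)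
  then have "rows M = rows N"
    by (rule map_injective) (auto intro: injI list_of_vec_inj)
  then show ?thesis
    using assms by (metis carrier_matD(2) mat_of_rows_rows)
qed

lemma concat_mat_entries_inj:
  assumes "set Ms \<subseteq> carrier_mat m n" "set Ns \<subseteq> carrier_mat m n" "length Ms = length Ns"
    and "concat (map mat_entries Ms) = concat (map mat_entries Ns)"
  shows "Ms = Ns"
proof -
  have "map mat_entries Ms = map mat_entries Ns"
    using assms
    by (intro concat_inj[of _ _ "m * n"]) (auto intro!: length_mat_entries)
  moreover have "inj_on mat_entries (set Ms \<union> set Ns)"
    using assms by (intro inj_onI mat_entries_inj[of _ m n]) auto
  ultimately show ?thesis
    by (simp add: inj_on_map_eq_map)
qed

lemma length_concat_mat_entries:
  "set Ms \<subseteq> carrier_mat m n \<Longrightarrow> length (concat (map mat_entries Ms)) = length Ms * (m * n)"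
  by (induction Ms) (auto simp: length_mat_entries)

lemma inj_on_encode: "inj_on encode {I. static_instance I}"
proof (rule inj_onI, unfold mem_Collect_eq)
  fix I J assume I: "static_instance I" and J: "static_instance J" and eq: "encode I = encode J"
  have d: "dim_x I = dim_x J" "dim_u I = dim_u J" "dim_vec (vec_a I) = dim_vec (vec_a J)"
    "dim_vec (vec_b I) = dim_vec (vec_b J)" "length (mats_H I) = length (mats_H J)"
    and e: "static_entries I = static_entries J"
    using eq by (auto simp: encode_def enc_nat_append_eq dest: concat_enc_rat_inj)
  note I' = I[unfolded static_instance_def d] and J' = J[unfolded static_instance_def]
  have lA: "length (mat_entries (mat_A I)) = length (mat_entries (mat_A J))"
    using I' J' by (metis length_mat_entries)
  have lB: "length (concat (map mat_entries (mats_B I))) =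
      length (concat (map mat_entries (mats_B J)))"
    using I' J' by (metis length_concat_mat_entries)
  have "list_of_vec (vec_a I) = list_of_vec (vec_a J)"
    "list_of_vec (vec_b I) = list_of_vec (vec_b J)"
    "mat_entries (mat_A I) = mat_entries (mat_A J)"
    "concat (map mat_entries (mats_B I)) = concat (map mat_entries (mats_B J))"
    "concat (map mat_entries (mats_H I)) = concat (map mat_entries (mats_H J))"
    using e lA lB d by (auto simp: static_entries_def)
  then have "vec_a I = vec_a J" "vec_b I = vec_b J" "mat_A I = mat_A J"
    "mats_B I = mats_B J" "mats_H I = mats_H J"
    using I' J' d
    by (auto intro: list_of_vec_inj mat_entries_inj concat_mat_entries_inj)
  with d show "I = J"
    by simp
qed

end

theory Submission
  imports Defs "HOL-Number_Theory.Cong" "HOL-Library.Nat_Bijection"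
begin

text \<open>
  Since $\mathcal{U}_c(x)$ can be made to consist of $x$ alone, Static expresses systems of quadratic
  equations in natural numbers, hence every Diophantine predicate. No reduction has to be carried
  out by a Turing machine: suppose that a machine \<open>M\<close> decides Static. The predicate
  ``\<open>M\<close> rejects the word $P\,\langle n\rangle\langle -n\rangle\,S$, where $n$ codes the pair
  $(P, S)$'' is recursively enumerable, so by the Davis-Putnam-Robinson-Matiyasevich theorem it is
  equivalent to an instance $I_n$ of Static in which $n$ occurs only as the two entries $n$ and
  $-n$ of $a$. Its encoding is $P\,\langle n\rangle\langle -n\rangle\,S$ for words $P$ and $S$
  that do not depend on $n$. For the number $n$ that codes this pair, $I_n$ is a yes-instance
  if and only if \<open>M\<close> rejects it.

  Computations are made Diophantine as in the work of Jones and Matiyasevich: a run of a machine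
  whose steps are affine maps on a few registers is packed digitwise into natural numbers, and the
  digits are controlled by the bitwise order, which is a parity of binomial coefficients.
\<close>

section \<open>The Pell equation\<close>

text \<open>The obstacle is that a run has unbounded length, and a quantifier over its times is not
  Diophantine as it stands. If every step is affine, the step equations of all times add up to one
  linear equation between packed numbers. Division by the tape base K is therefore never computed: a
  rule guesses the lowest digit t and matches the register with K y + t. Reading packed numbers
  digit by digit needs powers and a test of single bits. Both reduce to solutions of x^2 - (a^2 - 1)
  y^2 = 1, which grow exponentially in an index that congruences can recover. Rejection rather than
  acceptance is expressed, so that the instance asserts the opposite of the answer given to it. The
  number and its negative both occur because an equation for one coordinate of x has to be stated as
  two inequalities.\<close>

fun px :: "int \<Rightarrow> nat \<Rightarrow> int" and py :: "int \<Rightarrow> nat \<Rightarrow> int" where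
  "px a 0 = 1"
| "py a 0 = 0"
| "px a (Suc n) = a * px a n + (a^2 - 1) * py a n"
| "py a (Suc n) = px a n + a * py a n"

text \<open>The recursion multiplies by a + sqrt(a^2 - 1), whose n-th power has the components
  \<open>px a n\<close> and \<open>py a n\<close>. This factor has norm 1, and the norm is
  multiplicative.\<close>

lemma pell_eq: "px a n ^ 2 = (a^2 - 1) * py a n ^ 2 + 1"
proof (induction n)
  case (Suc n)
  have "px a (Suc n) ^ 2 - (a^2 - 1) * py a (Suc n) ^ 2 = px a n ^ 2 - (a^2 - 1) * py a n ^ 2"
    by (simp add: algebra_simps power2_eq_square)
  with Suc show ?case by simp
qed simp

lemma px_add: "px a (m + n) = px a m * px a n + (a^2 - 1) * py a m * py a n"
  and py_add: "py a (m + n) = px a m * py a n + py a m * px a n"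
proof (induction n)
  case (Suc n)
  { case 1 show ?case unfolding add_Suc_right px.simps py.simps Suc by (simp add: algebra_simps) }
  { case 2 show ?case unfolding add_Suc_right px.simps py.simps Suc by (simp add: algebra_simps) }
qed simp_all

text \<open>As the norm is 1, the inverse of a power is its conjugate, and the formula is the
  addition formula with the sign of one y changed.\<close>

lemma px_diff:
  assumes "n \<le> m"
  shows "px a (m - n) = px a m * px a n - (a^2 - 1) * py a m * py a n"
proof -
  obtain k where m: "m = k + n" using assms by (metis le_add_diff_inverse2)
  have "px a m * px a n - (a^2 - 1) * py a m * py a n
      = px a k * (px a n ^ 2 - (a^2 - 1) * py a n ^ 2)"
    unfolding m px_add py_add by (simp add: algebra_simps power2_eq_square)
  then show ?thesis using pell_eq[of a n] m by simp
qed

lemma px_double: "px a (2 * n) = 2 * px a n ^ 2 - 1"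
proof -
  have "px a (2 * n) = px a n ^ 2 + (a^2 - 1) * py a n ^ 2"
    unfolding mult_2 px_add by (simp add: power2_eq_square)
  then show ?thesis using pell_eq[of a n] by linarith
qed

lemma py_double: "py a (2 * n) = 2 * px a n * py a n"
  unfolding mult_2[of n] py_add by simp

context
  fixes a :: int
  assumes a: "a \<ge> 2"
begin

section \<open>Growth and completeness of the family of Pell solutions\<close>

lemma discriminant_pos: "a ^ 2 - 1 \<ge> 1"
  using power_mono[OF a, of 2] by simp

lemma discriminant_nonneg: "0 \<le> a ^ 2 - 1"
  using discriminant_pos by linarith

lemma px_pos: "px a n > 0" and py_nonneg: "py a n \<ge> 0"
proof (induction n)
  case (Suc n)
  { case 1 show ?case using mult_nonneg_nonneg[OF discriminant_nonneg Suc(2)] mult_pos_pos[OF _ Suc(1), of a] a by simp }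
  { case 2 show ?case using a Suc by simp }
qed simp_all

lemma px_Suc_ge: "a * px a n \<le> px a (Suc n)"
  using mult_nonneg_nonneg[OF discriminant_nonneg py_nonneg] by simp

lemma px_less_Suc: "px a n < px a (Suc n)" "2 * px a n \<le> px a (Suc n)"
proof -
  have "2 * px a n \<le> a * px a n" using a px_pos[of n] by simp
  then show "2 * px a n \<le> px a (Suc n)" using px_Suc_ge[of n] by linarith
  then show "px a n < px a (Suc n)" using px_pos[of n] by linarith
qed

lemma px_strict_mono: "strict_mono (px a)"
  using px_less_Suc strict_mono_Suc_iff by blast

lemma py_less_Suc: "py a n < py a (Suc n)"
proof -
  have "py a n \<le> a * py a n" using a py_nonneg[of n] mult_right_mono[of 1 a "py a n"] by simp
  then show ?thesis using px_pos[of n] by simp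
qed

lemma py_strict_mono: "strict_mono (py a)"
  using py_less_Suc strict_mono_Suc_iff by blast

lemma py_ge: "int n \<le> py a n"
proof (induction n)
  case (Suc n) then show ?case using py_less_Suc[of n] by linarith
qed simp

lemma px_ge_power: "a ^ n \<le> px a n"
proof (induction n)
  case (Suc n)
  have "a ^ Suc n \<le> a * px a n" using Suc a by simp
  then show ?case using px_Suc_ge[of n] by linarith
qed simp

text \<open>Descent: division by the fundamental solution a + sqrt(a^2 - 1) leads to a solution with
  smaller y.\<close>

lemma pell_complete:
  assumes "x ^ 2 = (a^2 - 1) * y ^ 2 + 1" "x \<ge> 0" "y \<ge> 0"
  shows "\<exists>n. x = px a n \<and> y = py a n"
  using assms
proof (induction "nat y" arbitrary: x y rule: less_induct)
  case less
  show ?case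
  proof (cases "y = 0")
    case True
    then have "x = 1" using less.prems by (simp add: power2_eq_1_iff)
    then show ?thesis using True by (intro exI[of _ 0]) simp
  next
    case False
    then have y: "y \<ge> 1" using less.prems by simp
    \<comment> \<open>The components of the product of x + y sqrt(a^2 - 1) and a - sqrt(a^2 -
      1).\<close>
    define x' y' where "x' = a * x - (a^2 - 1) * y" and "y' = a * y - x"
    have y2: "y ^ 2 \<ge> 1" using power_mono[OF y, of 2] by simp
    have "x ^ 2 \<le> (a * y) ^ 2"
      using less.prems(1) y2 by (simp add: power_mult_distrib algebra_simps)
    then have "x \<le> a * y" by (rule power2_le_imp_le) (use a y in simp)
    then have 1: "y' \<ge> 0" by (simp add: y'_def)
    have "((a - 1) * y) ^ 2 < x ^ 2"
    proof -
      have "(a - 1) ^ 2 \<le> a ^ 2 - 1" using a by (simp add: power2_eq_square algebra_simps)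
      then have "(a - 1) ^ 2 * y ^ 2 \<le> (a ^ 2 - 1) * y ^ 2" by (rule mult_right_mono) simp
      then show ?thesis using less.prems(1) by (simp add: power_mult_distrib)
    qed
    then have "(a - 1) * y < x" by (rule power2_less_imp_less) (use less.prems in simp)
    then have 2: "y' < y" by (simp add: y'_def algebra_simps)
    have "((a^2 - 1) * y) ^ 2 \<le> (a * x) ^ 2"
    proof -
      have "((a^2 - 1) * y) ^ 2 = (a^2 - 1) * ((a^2 - 1) * y ^ 2)" by (simp add: power2_eq_square)
      also have "\<dots> = (a^2 - 1) * (x^2 - 1)" using less.prems(1) by simp
      also have "\<dots> \<le> a ^ 2 * x ^ 2" by (rule mult_mono) (use mult_nonneg_nonneg[OF discriminant_nonneg zero_le_power2, of y] discriminant_nonneg less.prems(1) in linarith)+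
      finally show ?thesis by (simp add: power_mult_distrib)
    qed
    then have "(a^2 - 1) * y \<le> a * x" by (rule power2_le_imp_le) (use a less.prems in simp)
    then have 3: "x' \<ge> 0" by (simp add: x'_def)
    have "x' ^ 2 - (a^2 - 1) * y' ^ 2 = x ^ 2 - (a^2 - 1) * y ^ 2"
      unfolding x'_def y'_def by (simp add: power2_eq_square algebra_simps)
    then have 4: "x' ^ 2 = (a^2 - 1) * y' ^ 2 + 1" using less.prems(1) by simp
    obtain n where n: "x' = px a n" "y' = py a n"
      using less.hyps[of y' x', OF _ 4 3 1] 1 2 by auto
    have "x = px a (Suc n)" "y = py a (Suc n)"
      by (simp_all add: n[symmetric] x'_def y'_def power2_eq_square algebra_simps)
    then show ?thesis by blast
  qed
qed

section \<open>Divisibility between the y-components\<close>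

lemma coprime_px_py: "coprime (px a n) (py a n)"
proof (rule coprimeI)
  fix c assume "c dvd px a n" "c dvd py a n"
  then have "c dvd px a n ^ 2 - (a^2 - 1) * py a n ^ 2"
    by (simp add: power2_eq_square)
  then show "is_unit c" using pell_eq[of a n] by simp
qed

text \<open>Binomial expansion of the q-th power of the i-th solution: modulo the square of
  \<open>py a i\<close> only the terms of degree at most 1 in it survive.\<close>

lemma pell_mult_cong:
  "[px a (i * q) = px a i ^ q] (mod (py a i)^2) \<and>
   [py a (i * q) = int q * px a i ^ (q - 1) * py a i] (mod (py a i)^2)"
proof (induction q)
  case (Suc q)
  have yy: "py a i dvd py a (i * q)"
  proof -
    have "[py a (i * q) = int q * px a i ^ (q - 1) * py a i] (mod (py a i))"
      by (rule cong_dvd_modulus[OF conjunct2[OF Suc]]) (simp add: power2_eq_square)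
    then show ?thesis by (metis cong_dvd_iff dvd_triv_right)
  qed
  have c1: "[px a (i * q) = px a i ^ q] (mod (py a i)^2)"
    and c2: "[py a (i * q) = int q * px a i ^ (q - 1) * py a i] (mod (py a i)^2)"
    using Suc by blast+
  have "(py a i)^2 dvd (a^2 - 1) * (py a (i * q) * py a i)"
    unfolding power2_eq_square by (intro dvd_mult mult_dvd_mono yy dvd_refl)
  then have c3: "[(a^2 - 1) * py a (i * q) * py a i = 0] (mod (py a i)^2)"
    by (simp only: cong_0_iff mult.assoc)
  have "[px a (i * q) * px a i + (a^2 - 1) * py a (i * q) * py a i = px a i ^ q * px a i + 0]
      (mod (py a i)^2)"
    by (rule cong_add[OF cong_mult[OF c1 cong_refl] c3])
  then have 1: "[px a (i * Suc q) = px a i ^ Suc q] (mod (py a i)^2)"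
    unfolding mult_Suc_right add.commute[of i] px_add power_Suc2 by simp
  have "[px a (i * q) * py a i + py a (i * q) * px a i =
      px a i ^ q * py a i + int q * px a i ^ (q - 1) * py a i * px a i] (mod (py a i)^2)"
    by (rule cong_add[OF cong_mult[OF c1 cong_refl] cong_mult[OF c2 cong_refl]])
  moreover have "px a i ^ q * py a i + int q * px a i ^ (q - 1) * py a i * px a i
      = int (Suc q) * px a i ^ (Suc q - 1) * py a i"
    by (cases q) (simp_all add: algebra_simps)
  ultimately have 2: "[py a (i * Suc q) = int (Suc q) * px a i ^ (Suc q - 1) * py a i] (mod (py a i)^2)"
    unfolding mult_Suc_right add.commute[of i] py_add by (simp only:)
  from 1 2 show ?case by blast
qed simp

lemma py_dvd_mult: "py a i dvd py a (i * q)"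
proof -
  have "[py a (i * q) = int q * px a i ^ (q - 1) * py a i] (mod (py a i))"
    by (rule cong_dvd_modulus[OF conjunct2[OF pell_mult_cong]]) (simp add: power2_eq_square)
  then show ?thesis by (metis cong_dvd_iff dvd_triv_right)
qed

text \<open>Divide n by i with remainder r. By the addition formula \<open>py a i\<close> divides
  \<open>px a (i * q) * py a r\<close>; it is coprime to the first factor and larger than the
  second, which must vanish.\<close>

lemma py_dvd_imp_dvd:
  assumes "py a i dvd py a n" "i > 0"
  shows "i dvd n"
proof -
  define q r where "q = n div i" and "r = n mod i"
  have n: "n = i * q + r" by (simp add: q_def r_def)
  have cop: "coprime (py a i) (px a (i * q))"
    using coprime_px_py[of "i * q"] py_dvd_mult[of i q]
    by (meson coprime_commute coprime_divisors dvd_refl)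
  have "py a i dvd px a (i * q) * py a r"
    using assms(1) dvd_mult2[OF py_dvd_mult[of i q], of "px a r"]
    unfolding n py_add by (simp only: dvd_add_left_iff)
  then have "py a i dvd py a r" using cop by (simp add: coprime_dvd_mult_right_iff)
  moreover have "py a r < py a i"
    using py_strict_mono assms(2) by (simp add: r_def strict_mono_less)
  ultimately have "py a r = 0"
    using py_nonneg[of r] zdvd_imp_le[of "py a i" "py a r"] by linarith
  then have "r = 0" using py_ge[of r] by simp
  then show ?thesis using n by simp
qed

text \<open>Turns divisibility of a solution into divisibility of its index: with n = i q,
  cancelling \<open>py a i\<close> and the coprime power of \<open>px a i\<close> in
  \<open>pell_mult_cong\<close> leaves \<open>int q\<close>.\<close>

lemma py_sq_dvd_imp_dvd:
  assumes "(py a i)^2 dvd py a n" "i > 0"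
  shows "py a i dvd int n"
proof -
  have "py a i dvd py a n" using assms(1) by (metis dvd_trans dvd_triv_left power2_eq_square)
  then obtain q where n: "n = i * q" using py_dvd_imp_dvd assms(2) by blast
  have "(py a i)^2 dvd int q * px a i ^ (q - 1) * py a i"
    using assms(1) pell_mult_cong[of i q] unfolding n by (meson cong_dvd_iff)
  moreover have "py a i \<noteq> 0" using py_ge[of i] assms(2) by simp
  ultimately have "py a i dvd int q * px a i ^ (q - 1)"
    by (simp add: power2_eq_square)
  moreover have "coprime (py a i) (px a i ^ (q - 1))"
    using coprime_px_py[of i] by (simp add: coprime_commute)
  ultimately have "py a i dvd int q" by (simp add: coprime_dvd_mult_left_iff)
  then show ?thesis by (simp add: n)
qed

text \<open>Taking q = \<open>py a i\<close> in \<open>pell_mult_cong\<close> supplies the second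
  power.\<close>

lemma py_sq_dvd: "(py a i)^2 dvd py a (i * nat (py a i) * m)"
proof -
  have "(py a i)^2 dvd int (nat (py a i)) * px a i ^ (nat (py a i) - 1) * py a i"
    using py_nonneg[of i] by (simp add: power2_eq_square)
  then have "(py a i)^2 dvd py a (i * nat (py a i))"
    using pell_mult_cong[of i "nat (py a i)"] by (meson cong_dvd_iff)
  then show ?thesis using py_dvd_mult dvd_trans by blast
qed

text \<open>Modulo x_n one has x_(2n) = -1 and y_(2n) = 0, hence x_(2n+k) and x_(2n-k) are both
  -x_k. Such shifts and reflections bring every index into the range up to n; the signs of index and
  value need not be linked.\<close>

lemma px_reduce:
  assumes "n > 0"
  shows "\<exists>j'\<le>n. (2 * int n dvd int j - int j' \<or> 2 * int n dvd int j + int j') \<and>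
     (px a n dvd px a j - px a j' \<or> px a n dvd px a j + px a j')"
proof (induction j rule: less_induct)
  case (less j)
  have y0: "px a n dvd py a (2 * n)" unfolding py_double by simp
  consider "j \<le> n" | "n < j" "j \<le> 2 * n" | "2 * n < j" by linarith
  then show ?case
  proof cases
    case 1 then show ?thesis by (intro exI[of _ j]) simp
  next
    case 2
    define j' where "j' = 2 * n - j"
    have "px a j = px a (2 * n - j')" using 2 by (simp add: j'_def)
    also have "\<dots> = px a (2 * n) * px a j' - (a^2 - 1) * py a (2 * n) * py a j'"
      by (rule px_diff) (simp add: j'_def)
    finally have "px a j + px a j' = 2 * px a n ^ 2 * px a j' - (a^2 - 1) * py a (2 * n) * py a j'"
      unfolding px_double by (simp add: left_diff_distrib)
    then have "px a n dvd px a j + px a j'"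
      using y0 by (simp add: power2_eq_square)
    moreover have "2 * int n dvd int j + int j'" using 2 by (simp add: j'_def of_nat_diff)
    moreover have "j' \<le> n" using 2 by (simp add: j'_def)
    ultimately show ?thesis by blast
  next
    case 3
      define k where "k = j - 2 * n"
      have "k < j" using 3 assms by (simp add: k_def)
      then obtain j' where j': "j' \<le> n" "2 * int n dvd int k - int j' \<or> 2 * int n dvd int k + int j'"
        "px a n dvd px a k - px a j' \<or> px a n dvd px a k + px a j'"
        using less.IH by blast
      have j: "j = 2 * n + k" using 3 by (simp add: k_def)
      have "px a j + px a k = 2 * px a n ^ 2 * px a k + (a^2 - 1) * py a (2 * n) * py a k"
        unfolding j px_add px_double by (simp add: left_diff_distrib)
      then have d: "px a n dvd px a j + px a k"
        using y0 by (simp add: power2_eq_square)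
      have "px a n dvd px a j - px a j' \<or> px a n dvd px a j + px a j'"
        using j'(3)
      proof
        assume "px a n dvd px a k - px a j'"
        from dvd_diff[OF d this] show ?thesis by simp
      next
        assume "px a n dvd px a k + px a j'"
        from dvd_diff[OF d this] show ?thesis by simp
      qed
      moreover have "2 * int n dvd int j - int j' \<or> 2 * int n dvd int j + int j'"
      proof -
        have "int j - int j' = 2 * int n + (int k - int j')" "int j + int j' = 2 * int n + (int k + int j')"
          by (simp_all add: j)
        then show ?thesis using j'(2) by (metis dvd_add dvd_refl)
      qed
      ultimately show ?thesis using j'(1) by blast
  qed
qed

text \<open>Each x is at least twice its predecessor, so for i < j < n even the sum of x_i and x_j
  is below x_n. For j = n the modulus would have to divide the smaller x_i alone.\<close>

lemma px_le_inj:
  assumes "i \<le> n" "j \<le> n" "px a n dvd px a i - px a j \<or> px a n dvd px a i + px a j"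
  shows "i = j"
  using assms
proof (induction i j rule: linorder_wlog)
  case (le i j)
  show ?case
  proof (rule ccontr)
    assume "i \<noteq> j"
    with le have ij: "i < j" by simp
    then have lt: "px a i < px a j" using px_strict_mono by (simp add: strict_mono_less)
    have jn: "px a j \<le> px a n" using px_strict_mono le by (simp add: strict_mono_less_eq)
    have "\<not> px a n dvd px a j - px a i"
      using zdvd_imp_le[of "px a n" "px a j - px a i"] lt jn px_pos[of i] by linarith
    then have sum: "px a n dvd px a i + px a j"
      using le dvd_diff_commute[of "px a n" "px a i" "px a j"] by blast
    show False
    proof (cases "j = n")
      case True
      then have "px a n dvd px a i" using sum by simp
      then show False using zdvd_imp_le[of "px a n" "px a i"] lt jn px_pos[of i] by linarith
    next
      case False
      then have "px a (Suc j) \<le> px a n" using px_strict_mono le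
        by (simp add: strict_mono_less_eq Suc_le_eq del: px.simps)
      then have "px a i + px a j < px a n" using px_less_Suc(2)[of j] lt by linarith
      then show False using sum zdvd_imp_le[of "px a n" "px a i + px a j"] px_pos[of i] px_pos[of j]
        by linarith
    qed
  qed
next
  case (sym i j)
  then show ?case using dvd_diff_commute[of "px a n" "px a i" "px a j"] by (simp add: add.commute)
qed

lemma px_cong_imp:
  assumes "[px a i = px a j] (mod px a n)" "n > 0"
  shows "2 * int n dvd int i - int j \<or> 2 * int n dvd int i + int j"
proof -
  obtain i' where i': "i' \<le> n" "2 * int n dvd int i - int i' \<or> 2 * int n dvd int i + int i'"
    "px a n dvd px a i - px a i' \<or> px a n dvd px a i + px a i'"
    using px_reduce[OF assms(2), of i] by blast
  obtain j' where j': "j' \<le> n" "2 * int n dvd int j - int j' \<or> 2 * int n dvd int j + int j'"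
    "px a n dvd px a j - px a j' \<or> px a n dvd px a j + px a j'"
    using px_reduce[OF assms(2), of j] by blast
  have d: "px a n dvd px a i - px a j" using assms by (simp add: cong_iff_dvd_diff)
  have "px a n dvd px a i' - px a j' \<or> px a n dvd px a i' + px a j'"
    using i'(3)
  proof
    assume *: "px a n dvd px a i - px a i'"
    from j'(3) show ?thesis
    proof
      assume "px a n dvd px a j - px a j'"
      from dvd_add[OF dvd_diff[OF d *] this] show ?thesis by simp
    next
      assume "px a n dvd px a j + px a j'"
      from dvd_add[OF dvd_diff[OF d *] this] show ?thesis by simp
    qed
  next
    assume *: "px a n dvd px a i + px a i'"
    from j'(3) show ?thesis
    proof
      assume "px a n dvd px a j - px a j'"
      from dvd_diff[OF dvd_diff[OF * d] this] show ?thesis by simp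
    next
      assume "px a n dvd px a j + px a j'"
      from dvd_diff[OF dvd_diff[OF * d] this] show ?thesis by simp
    qed
  qed
  then have eq: "i' = j'" by (rule px_le_inj[OF i'(1) j'(1)])
  from i'(2) show ?thesis
  proof
    assume *: "2 * int n dvd int i - int i'"
    from j'(2) show ?thesis
    proof
      assume "2 * int n dvd int j - int j'"
      from dvd_diff[OF * this] show ?thesis by (simp add: eq)
    next
      assume "2 * int n dvd int j + int j'"
      from dvd_add[OF * this] show ?thesis by (simp add: eq)
    qed
  next
    assume *: "2 * int n dvd int i + int i'"
    from j'(2) show ?thesis
    proof
      assume "2 * int n dvd int j - int j'"
      from dvd_add[OF * this] show ?thesis by (simp add: eq)
    next
      assume "2 * int n dvd int j + int j'"
      from dvd_diff[OF * this] show ?thesis by (simp add: eq)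
    qed
  qed
qed

text \<open>Modulo a - 1 the base is 1 and the discriminant is 0, so the recursion merely counts
  steps. This lets a congruence read off the index.\<close>

lemma py_cong_index: "[py a n = int n] (mod a - 1)"
  and px_cong_1: "[px a n = 1] (mod a - 1)"
proof (induction n)
  case (Suc n)
  have sq: "[a ^ 2 - 1 = 0] (mod a - 1)" by (simp add: cong_0_iff power2_eq_square dvd_def algebra_simps) (rule exI[of _ "a+1"], simp add: algebra_simps)
  have a1: "[a = 1] (mod a - 1)" by (simp add: cong_iff_dvd_diff)
  {
    case 1
    show ?case using cong_add[OF Suc(2) cong_mult[OF a1 Suc(1)]] by simp
  next
    case 2
    show ?case using cong_add[OF cong_mult[OF a1 Suc(2)] cong_mult[OF sq cong_refl]] by simp
  }
qed simp_all

text \<open>The modulus is D - (a - k)^2 for D = a^2 - 1. Hence k - a acts as a square root of D,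
  and a + sqrt(D) becomes k.\<close>

lemma pell_power_cong:
  "[px a n - (a - k) * py a n = k ^ n] (mod 2 * a * k - k^2 - 1)"
proof (induction n)
  case (Suc n)
  have "px a (Suc n) - (a - k) * py a (Suc n)
      = k * (px a n - (a - k) * py a n) + (2 * a * k - k^2 - 1) * py a n"
    by (simp add: algebra_simps power2_eq_square)
  also have "[\<dots> = k * k ^ n + 0] (mod 2 * a * k - k^2 - 1)"
    by (intro cong_add cong_mult Suc cong_refl) (simp add: cong_0_iff)
  finally show ?case by simp
qed simp

end

text \<open>The components are integer polynomials in the base. This links the solutions for
  \<open>b\<close> and for \<open>a\<close> modulo \<open>u\<close> below.\<close>

lemma pell_cong_base:
  assumes "[a = b] (mod m)"
  shows "[px a n = px b n] (mod m)" "[py a n = py b n] (mod m)"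
proof (induction n)
  case (Suc n)
  { case 1 show ?case
      unfolding px.simps by (intro cong_add cong_mult cong_diff cong_pow assms Suc cong_refl) }
  { case 2 show ?case
      unfolding py.simps by (intro cong_add cong_mult assms Suc) }
qed simp_all

text \<open>
  Matiyasevich's trick: $y^2 \mid v$ makes $2y$ divide the period $2n$ of the sequence $x_j$ modulo
  $u = x_n$. The congruences on \<open>s\<close> then determine the index \<open>j\<close> of the solution
  \<open>(s, t)\<close> up to sign modulo $2y$, and those on \<open>t\<close> identify it with \<open>k\<close>.
\<close>

lemma py_characterisation:
  fixes a k x y :: int
  assumes a: "a \<ge> 2" and k: "k \<ge> 1" "y \<ge> k" "x \<ge> 0"
  shows "x = px a (nat k) \<and> y = py a (nat k) \<longleftrightarrow>
    (\<exists>u v s t b. u \<ge> 0 \<and> v > 0 \<and> s \<ge> 0 \<and> t \<ge> 0 \<and> b \<ge> 2 \<and>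
      x^2 = (a^2 - 1) * y^2 + 1 \<and> u^2 = (a^2 - 1) * v^2 + 1 \<and> s^2 = (b^2 - 1) * t^2 + 1 \<and>
      y^2 dvd v \<and> [b = 1] (mod 2 * y) \<and> [b = a] (mod u) \<and> [s = x] (mod u) \<and> [t = k] (mod 2 * y))"
    (is "?L \<longleftrightarrow> ?R")
proof
  assume ?R
  then obtain u v s t b where *: "u \<ge> 0" "v > 0" "s \<ge> 0" "t \<ge> 0" "b \<ge> 2"
      "x^2 = (a^2 - 1) * y^2 + 1" "u^2 = (a^2 - 1) * v^2 + 1" "s^2 = (b^2 - 1) * t^2 + 1"
      "y^2 dvd v" "[b = 1] (mod 2 * y)" "[b = a] (mod u)" "[s = x] (mod u)" "[t = k] (mod 2 * y)"
    by blast
  obtain i where i: "x = px a i" "y = py a i" using pell_complete[OF a *(6)] k by auto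
  obtain n where n: "u = px a n" "v = py a n" using pell_complete[OF a *(7)] * by auto
  obtain j where j: "s = px b j" "t = py b j" using pell_complete[OF *(5,8)] * by auto
  have i0: "i > 0" and n0: "n > 0" using k i *(2) n by (auto intro!: Nat.gr0I)
  have "y dvd int n" using py_sq_dvd_imp_dvd[OF a, of i n] *(9) i n i0 by simp
  then have yn: "2 * y dvd 2 * int n" by simp
  have "[px a j = px b j] (mod px a n)"
    using pell_cong_base(1)[OF *(11)] by (simp add: n cong_sym)
  also have "[px b j = px a i] (mod px a n)" using *(12) by (simp add: i j n)
  finally have "2 * int n dvd int j - int i \<or> 2 * int n dvd int j + int i"
    using px_cong_imp[OF a _ n0] by blast
  then have ji: "2 * y dvd int j - int i \<or> 2 * y dvd int j + int i"
    using yn dvd_trans by blast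
  have "[py b j = int j] (mod 2 * y)"
    by (rule cong_dvd_modulus[OF py_cong_index[OF *(5)]]) (use *(10) in \<open>simp add: cong_iff_dvd_diff\<close>)
  then have "[k = int j] (mod 2 * y)"
    using *(13) by (metis j(2) cong_sym cong_trans)
  then have kj: "2 * y dvd k - int j" by (simp add: cong_iff_dvd_diff)
  have iy: "int i \<le> y" using py_ge[OF a] i by simp
  \<comment> \<open>Both \<open>k\<close> and \<open>i\<close> lie between 1 and \<open>y\<close>:
    their difference is too small for \<open>2 * y\<close>, and their sum reaches it only if both
    equal \<open>y\<close>.\<close>
  from ji have "2 * y dvd k - int i \<or> 2 * y dvd k + int i"
  proof
    assume "2 * y dvd int j - int i"
    from dvd_add[OF kj this] show ?thesis by simp
  next
    assume "2 * y dvd int j + int i"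
    from dvd_add[OF kj this] show ?thesis by simp
  qed
  then have "k = int i"
  proof
    assume "2 * y dvd k - int i"
    moreover have "\<bar>k - int i\<bar> < 2 * y" using iy k i0 by linarith
    ultimately show ?thesis using dvd_imp_le_int[of "k - int i" "2 * y"] by linarith
  next
    assume "2 * y dvd k + int i"
    then have "2 * y \<le> k + int i" using zdvd_imp_le[of "2 * y" "k + int i"] k i0 by linarith
    then show ?thesis using iy k by linarith
  qed
  then show ?L using i by simp
next
  assume ?L
  define i where "i = nat k"
  have i: "x = px a i" "y = py a i" "i > 0" "int i = k" using \<open>?L\<close> k by (auto simp: i_def)
  define m where "m = i * nat y * 1"
  \<comment> \<open>The doubled index makes \<open>v\<close> divisible by \<open>2 * y\<close> and
    hence \<open>u\<close> coprime to it, as the Chinese remainder theorem requires.\<close>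
  define u v where "u = px a (2 * m)" and "v = py a (2 * m)"
  have y0: "y > 0" using k by linarith
  have ym: "y^2 dvd py a m" unfolding m_def i(2) by (rule py_sq_dvd[OF a])
  then have yv: "y^2 dvd v" unfolding v_def py_double by simp
  have "2 * y dvd v"
  proof -
    have "y dvd py a m" using ym by (metis dvd_trans dvd_triv_left power2_eq_square)
    then show ?thesis unfolding v_def py_double by (intro mult_dvd_mono) simp_all
  qed
  then have "coprime u (2 * y)"
    using coprime_px_py[OF a, of "2 * m"] unfolding u_def v_def by (meson coprime_divisors dvd_refl)
  then have "\<exists>b0. [b0 = a] (mod u) \<and> [b0 = 1] (mod 2 * y)"
    using binary_chinese_remainder_int by blast
  then obtain b0 where b0: "[b0 = a] (mod u)" "[b0 = 1] (mod 2 * y)" by blast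
  have u0: "u > 0" unfolding u_def using px_pos[OF a] .
  \<comment> \<open>A multiple of both moduli is added to bring the Chinese remainder solution to at
    least 2.\<close>
  define b where "b = b0 + (\<bar>b0\<bar> + 2) * (u * (2 * y))"
  have "(\<bar>b0\<bar> + 2) * 1 \<le> (\<bar>b0\<bar> + 2) * (u * (2 * y))"
    by (rule mult_left_mono) (use mult_pos_pos[OF u0, of "2 * y"] y0 in linarith)+
  then have "b0 + (\<bar>b0\<bar> + 2) \<le> b" unfolding b_def mult_1_right by (rule add_left_mono)
  then have b2: "b \<ge> 2" by linarith
  have b: "[b = a] (mod u)" "[b = 1] (mod 2 * y)"
    using b0 unfolding b_def cong_iff_dvd_diff
    by (metis add_diff_eq add.commute diff_add_eq dvd_add dvd_mult dvd_triv_left,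
        metis add_diff_eq add.commute diff_add_eq dvd_add dvd_mult dvd_triv_right)
  define s t where "s = px b i" and "t = py b i"
  have "m > 0" using i y0 by (simp add: m_def)
  then have "v > 0" unfolding v_def using py_ge[OF a, of "2 * m"] by linarith
  moreover have "[s = x] (mod u)" unfolding s_def i by (rule pell_cong_base(1)[OF b(1)])
  moreover have "[t = k] (mod 2 * y)"
    unfolding t_def i(4)[symmetric]
    by (rule cong_dvd_modulus[OF py_cong_index[OF b2]]) (use b(2) in \<open>simp add: cong_iff_dvd_diff\<close>)
  moreover have "x^2 = (a^2 - 1) * y^2 + 1" "u^2 = (a^2 - 1) * v^2 + 1" "s^2 = (b^2 - 1) * t^2 + 1"
    unfolding i(1,2) u_def v_def s_def t_def by (rule pell_eq)+
  moreover have "s \<ge> 0" "t \<ge> 0" unfolding s_def t_def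
    using px_pos[OF b2, of i] py_nonneg[OF b2, of i] by linarith+
  ultimately show ?R using b b2 yv u0 by (intro exI[of _ u] exI[of _ v] exI[of _ s] exI[of _ t] exI[of _ b]) auto
qed

section \<open>Diophantine predicates\<close>

text \<open>All numbers are natural and there is no subtraction, so an equation has a polynomial on
  each side. \<open>Par\<close> refers to given numbers, \<open>Aux\<close> to existentially
  quantified unknowns.\<close>

datatype dpoly = Par nat | Aux nat | Num nat | Add dpoly dpoly | Mul dpoly dpoly

primrec dval :: "dpoly \<Rightarrow> (nat \<Rightarrow> nat) \<Rightarrow> (nat \<Rightarrow> nat) \<Rightarrow> nat" where
  "dval (Par i) v w = v i"
| "dval (Aux i) v w = w i"
| "dval (Num c) v w = c"
| "dval (Add p q) v w = dval p v w + dval q v w"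
| "dval (Mul p q) v w = dval p v w * dval q v w"

primrec dsubst :: "(nat \<Rightarrow> dpoly) \<Rightarrow> (nat \<Rightarrow> dpoly) \<Rightarrow> dpoly \<Rightarrow> dpoly" where
  "dsubst f g (Par i) = f i"
| "dsubst f g (Aux i) = g i"
| "dsubst f g (Num c) = Num c"
| "dsubst f g (Add p q) = Add (dsubst f g p) (dsubst f g q)"
| "dsubst f g (Mul p q) = Mul (dsubst f g p) (dsubst f g q)"

lemma dval_dsubst:
  "dval (dsubst f g p) v w = dval p (\<lambda>i. dval (f i) v w) (\<lambda>i. dval (g i) v w)"
  by (induction p) simp_all

definition sat :: "(dpoly \<times> dpoly) list \<Rightarrow> (nat \<Rightarrow> nat) \<Rightarrow> (nat \<Rightarrow> nat) \<Rightarrow> bool" where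
  "sat es v w \<longleftrightarrow> (\<forall>(p, q) \<in> set es. dval p v w = dval q v w)"

definition esubst ::
  "(nat \<Rightarrow> dpoly) \<Rightarrow> (nat \<Rightarrow> dpoly) \<Rightarrow> (dpoly \<times> dpoly) list \<Rightarrow> (dpoly \<times> dpoly) list" where
  "esubst f g = map (map_prod (dsubst f g) (dsubst f g))"

lemma sat_esubst:
  "sat (esubst f g es) v = (\<lambda>w. sat es (\<lambda>i. dval (f i) v w) (\<lambda>i. dval (g i) v w))"
  by (fastforce simp: sat_def esubst_def dval_dsubst)

lemma sat_Nil: "sat [] v = (\<lambda>w. True)"
  and sat_Cons: "sat ((p, q) # es) v = (\<lambda>w. dval p v w = dval q v w \<and> sat es v w)"
  and sat_append: "sat (es @ es') v = (\<lambda>w. sat es v w \<and> sat es' v w)"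
  by (simp_all add: sat_def fun_eq_iff ball_Un)

definition dioph :: "((nat \<Rightarrow> nat) \<Rightarrow> bool) \<Rightarrow> bool" where
  "dioph P \<longleftrightarrow> (\<exists>es. \<forall>v. P v \<longleftrightarrow> (\<exists>w. sat es v w))"

text \<open>Polynomials in the given numbers alone. Separating them from relations lets the closure
  rules below follow the syntax of a formula.\<close>

definition dfun :: "((nat \<Rightarrow> nat) \<Rightarrow> nat) \<Rightarrow> bool" where
  "dfun f \<longleftrightarrow> (\<exists>p. \<forall>v w. dval p v w = f v)"

named_theorems dioph_intros

lemma dfun_var [dioph_intros]: "dfun (\<lambda>v. v i)"
  unfolding dfun_def by (rule exI[of _ "Par i"]) simp

lemma dfun_const [dioph_intros]: "dfun (\<lambda>v. c)"
  unfolding dfun_def by (rule exI[of _ "Num c"]) simp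

lemma dfun_add [dioph_intros]: "dfun f \<Longrightarrow> dfun g \<Longrightarrow> dfun (\<lambda>v. f v + g v)"
  unfolding dfun_def by (metis dval.simps(4))

lemma dfun_mult [dioph_intros]: "dfun f \<Longrightarrow> dfun g \<Longrightarrow> dfun (\<lambda>v. f v * g v)"
  unfolding dfun_def by (metis dval.simps(5))

lemma dfun_Suc [dioph_intros]: "dfun f \<Longrightarrow> dfun (\<lambda>v. Suc (f v))"
  using dfun_add[OF dfun_const[of 1]] by simp

lemma dfun_sum [dioph_intros]: "(\<And>i. dfun (f i)) \<Longrightarrow> dfun (\<lambda>v. \<Sum>i<n. f i v)"
  for n :: nat
  by (induction n) (simp_all add: dfun_const dfun_add)

lemma dioph_eq [dioph_intros]:
  assumes "dfun f" "dfun g"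
  shows "dioph (\<lambda>v. f v = g v)"
proof -
  obtain p q where "\<forall>v w. dval p v w = f v" "\<forall>v w. dval q v w = g v"
    using assms unfolding dfun_def by blast
  then show ?thesis
    unfolding dioph_def by (intro exI[of _ "[(p, q)]"]) (simp add: sat_Cons sat_Nil)
qed

text \<open>Even and odd positions carry the two assignments, which gives two systems disjoint
  unknowns.\<close>

lemma merge_ex: "(\<exists>w w'. P w w') \<longleftrightarrow> (\<exists>w :: nat \<Rightarrow> 'a. P (\<lambda>i. w (2 * i)) (\<lambda>i. w (Suc (2 * i))))"
proof
  assume "\<exists>w w'. P w w'"
  then obtain w w' where "P w w'" by blast
  then show "\<exists>w :: nat \<Rightarrow> 'a. P (\<lambda>i. w (2 * i)) (\<lambda>i. w (Suc (2 * i)))"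
    by (intro exI[of _ "\<lambda>i. if even i then w (i div 2) else w' (i div 2)"]) simp
qed blast

lemma dioph_conj [dioph_intros]:
  assumes "dioph P" "dioph Q"
  shows "dioph (\<lambda>v. P v \<and> Q v)"
proof -
  obtain es es' where "\<forall>v. P v \<longleftrightarrow> (\<exists>w. sat es v w)" "\<forall>v. Q v \<longleftrightarrow> (\<exists>w. sat es' v w)"
    using assms unfolding dioph_def by blast
  then have "P v \<and> Q v \<longleftrightarrow> (\<exists>w w'. sat es v w \<and> sat es' v w')" for v by blast
  then show ?thesis
    unfolding dioph_def merge_ex
    by (intro exI[of _ "esubst Par (\<lambda>i. Aux (2 * i)) es @ esubst Par (\<lambda>i. Aux (Suc (2 * i))) es'"])
       (simp add: sat_append sat_esubst)
qed

text \<open>Two new unknowns with sum 1 multiply the equations of the two systems: one of the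
  systems is switched off, so both can share the remaining unknowns.\<close>

lemma dioph_disj [dioph_intros]:
  assumes "dioph P" "dioph Q"
  shows "dioph (\<lambda>v. P v \<or> Q v)"
proof -
  obtain es es' where P: "\<forall>v. P v \<longleftrightarrow> (\<exists>w. sat es v w)" and Q: "\<forall>v. Q v \<longleftrightarrow> (\<exists>w. sat es' v w)"
    using assms unfolding dioph_def by blast
  define sw where "sw i = map (map_prod (Mul (Aux i)) (Mul (Aux i)))" for i
  have sw: "sat (sw i ds) v = (\<lambda>w. w i = 0 \<or> sat ds v w)" for i ds v
    by (fastforce simp: sat_def sw_def)
  define sh where "sh = esubst Par (\<lambda>i. Aux (Suc (Suc i)))"
  have "P v \<or> Q v \<longleftrightarrow> (\<exists>w. sat ((Add (Aux 0) (Aux 1), Num 1) # sw 0 (sh es) @ sw 1 (sh es')) v w)"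
    (is "_ \<longleftrightarrow> (\<exists>w. ?R w)") for v
  proof
    assume "P v \<or> Q v"
    then show "\<exists>w. ?R w"
    proof
      assume "P v"
      then obtain w where "sat es v w" using P by blast
      then show ?thesis
        by (intro exI[of _ "case_nat 1 (case_nat 0 w)"])
           (simp add: sat_Cons sat_append sw sh_def sat_esubst)
    next
      assume "Q v"
      then obtain w where "sat es' v w" using Q by blast
      then show ?thesis
        by (intro exI[of _ "case_nat 0 (case_nat 1 w)"])
           (simp add: sat_Cons sat_append sw sh_def sat_esubst)
    qed
  next
    assume "\<exists>w. ?R w"
    then obtain w where "?R w" by blast
    then have "w 0 + w 1 = 1" "w 0 = 0 \<or> sat es v (\<lambda>i. w (Suc (Suc i)))"
      "w 1 = 0 \<or> sat es' v (\<lambda>i. w (Suc (Suc i)))"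
      by (simp_all add: sat_Cons sat_append sw sh_def sat_esubst)
    then show "P v \<or> Q v" using P Q by auto
  qed
  then show ?thesis unfolding dioph_def by blast
qed

text \<open>Variables are de Bruijn indices: 0 is the bound variable and the others move up by
  one.\<close>

lemma dioph_ex [dioph_intros]:
  assumes "dioph (\<lambda>v. P (v 0) (\<lambda>i. v (Suc i)))"
  shows "dioph (\<lambda>v. \<exists>x. P x v)"
proof -
  obtain es where "\<forall>v. P (v 0) (\<lambda>i. v (Suc i)) \<longleftrightarrow> (\<exists>w. sat es v w)"
    using assms unfolding dioph_def by blast
  then have es: "P x v \<longleftrightarrow> (\<exists>w. sat es (case_nat x v) w)" for x v
    by (metis (no_types, lifting) ext nat.simps(4,5))
  let ?f = "\<lambda>i. case i of 0 \<Rightarrow> Aux 0 | Suc i \<Rightarrow> Par i"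
  have f: "(\<lambda>i. dval (?f i) v w) = case_nat (w 0) v" for v w
    by (auto split: nat.split)
  have "(\<exists>x. P x v) \<longleftrightarrow> (\<exists>w. sat (esubst ?f (\<lambda>i. Aux (Suc i)) es) v w)" (is "_ \<longleftrightarrow> (\<exists>w. ?R w)") for v
  proof
    assume "\<exists>x. P x v"
    then obtain x w where "sat es (case_nat x v) w" using es by blast
    then show "\<exists>w. ?R w"
      by (intro exI[of _ "case_nat x w"]) (simp add: sat_esubst f)
  next
    assume "\<exists>w. ?R w"
    then show "\<exists>x. P x v" unfolding sat_esubst f es by auto
  qed
  then show ?thesis unfolding dioph_def by blast
qed

text \<open>A whole sequence can be bound because the unknowns already form an infinite sequence
  with room for it. It serves for the family \<open>E\<close> of a packed run, and its version for
  double sequences for \<open>Y\<close>.\<close>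

lemma dioph_ex_fun [dioph_intros]:
  assumes "dioph (\<lambda>v. P (\<lambda>i. v (2 * i)) (\<lambda>i. v (Suc (2 * i))))"
  shows "dioph (\<lambda>v. \<exists>x. P x v)"
proof -
  obtain es where es: "\<forall>v. P (\<lambda>i. v (2 * i)) (\<lambda>i. v (Suc (2 * i))) \<longleftrightarrow> (\<exists>w. sat es v w)"
    using assms unfolding dioph_def by blast
  define mix :: "(nat \<Rightarrow> nat) \<Rightarrow> _" where
    "mix x v = (\<lambda>i. if even i then x (i div 2) else v (i div 2))" for x v
  have es: "P x v \<longleftrightarrow> (\<exists>w. sat es (mix x v) w)" for x v
    using es[rule_format, of "mix x v"] by (simp add: mix_def)
  let ?f = "\<lambda>i. if even i then Aux (2 * (i div 2)) else Par (i div 2)"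
  have f: "(\<lambda>i. dval (?f i) v w) = mix (\<lambda>i. w (2 * i)) v" for v w
    by (auto simp: mix_def)
  have "(\<exists>x. P x v) \<longleftrightarrow> (\<exists>x w. sat es (mix x v) w)" for v using es by blast
  then show ?thesis unfolding dioph_def merge_ex
    by (intro exI[of _ "esubst ?f (\<lambda>i. Aux (Suc (2 * i))) es"]) (simp add: sat_esubst f)
qed

lemma dioph_ex_fun2 [dioph_intros]:
  assumes "dioph (\<lambda>v. P (\<lambda>i j. v (2 * prod_encode (i, j))) (\<lambda>i. v (Suc (2 * i))))"
  shows "dioph (\<lambda>v. \<exists>x. P x v)"
proof -
  have "(\<exists>x. P x v) \<longleftrightarrow> (\<exists>x. P (\<lambda>i j. x (prod_encode (i, j))) v)" for v
  proof
    assume "\<exists>x. P x v"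
    then obtain x where "P x v" by blast
    then show "\<exists>x. P (\<lambda>i j. x (prod_encode (i, j))) v"
      by (intro exI[of _ "\<lambda>n. case_prod x (prod_decode n)"]) simp
  qed blast
  then show ?thesis using dioph_ex_fun[OF assms] by simp
qed

lemma dioph_subst:
  assumes "dioph P" "\<And>i. dfun (t i)"
  shows "dioph (\<lambda>v. P (\<lambda>i. t i v))"
proof -
  obtain es where es: "\<forall>v. P v \<longleftrightarrow> (\<exists>w. sat es v w)"
    using assms(1) unfolding dioph_def by blast
  obtain p where p: "\<And>i v w. dval (p i) v w = t i v"
    using assms(2) unfolding dfun_def by metis
  show ?thesis unfolding dioph_def
    by (intro exI[of _ "esubst p Aux es"]) (simp add: sat_esubst p es)
qed

lemma dioph_True [dioph_intros]: "dioph (\<lambda>v. True)"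
  unfolding dioph_def by (intro exI[of _ "[]"]) (simp add: sat_Nil)

text \<open>The bound is a fixed number, so this is a finite conjunction. Bounds that vary are what
  the packing of runs has to replace.\<close>

lemma dioph_all_less [dioph_intros]:
  "(\<And>i. dioph (P i)) \<Longrightarrow> dioph (\<lambda>v. \<forall>i<n. P i v)" for n :: nat
  by (induction n) (simp_all add: dioph_True dioph_conj less_Suc_eq all_conj_distrib imp_disjL)

text \<open>It suffices to treat a relation between variables; polynomials are substituted
  afterwards.\<close>

lemma dioph_rel2:
  assumes "dioph (\<lambda>v. R (v 0) (v 1))" "dfun f" "dfun g"
  shows "dioph (\<lambda>v. R (f v) (g v))"
proof -
  have "dfun (if i = 0 then f else g)" for i :: nat using assms by simp
  from dioph_subst[OF assms(1), of "\<lambda>i. if i = 0 then f else g", OF this] show ?thesis by simp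
qed

lemma dioph_rel3:
  assumes "dioph (\<lambda>v. R (v 0) (v 1) (v 2))" "dfun f" "dfun g" "dfun h"
  shows "dioph (\<lambda>v. R (f v) (g v) (h v))"
proof -
  have "dfun (if i = 0 then f else if i = 1 then g else h)" for i :: nat using assms by simp
  from dioph_subst[OF assms(1), of "\<lambda>i. if i = 0 then f else if i = 1 then g else h", OF this]
  show ?thesis by simp
qed

lemma dioph_rel4:
  assumes "dioph (\<lambda>v. R (v 0) (v 1) (v 2) (v 3))" "dfun f" "dfun g" "dfun h" "dfun k"
  shows "dioph (\<lambda>v. R (f v) (g v) (h v) (k v))"
proof -
  have "dfun (if i = 0 then f else if i = 1 then g else if i = 2 then h else k)" for i :: nat
    using assms by simp
  from dioph_subst[OF assms(1), of "\<lambda>i. if i = 0 then f else if i = 1 then g else if i = 2 then h else k", OF this]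
  show ?thesis by simp
qed

lemma dioph_le [dioph_intros]: "dfun f \<Longrightarrow> dfun g \<Longrightarrow> dioph (\<lambda>v. f v \<le> g v)"
  by (rule dioph_rel2) (unfold le_iff_add, intro dioph_intros)

lemma dioph_less [dioph_intros]: "dfun f \<Longrightarrow> dfun g \<Longrightarrow> dioph (\<lambda>v. f v < g v)"
  unfolding Suc_le_eq[symmetric] by (intro dioph_intros)

lemma dioph_dvd [dioph_intros]: "dfun f \<Longrightarrow> dfun g \<Longrightarrow> dioph (\<lambda>v. f v dvd g v)"
  by (rule dioph_rel2) (unfold dvd_def, intro dioph_intros)

lemma dioph_odd [dioph_intros]: "dfun f \<Longrightarrow> dioph (\<lambda>v. odd (f v))"
  using dioph_dvd[OF dfun_const[of 2] dfun_Suc[of f]] by simp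

lemma dioph_cong [dioph_intros]:
  "dfun f \<Longrightarrow> dfun g \<Longrightarrow> dfun h \<Longrightarrow> dioph (\<lambda>v. [f v = g v] (mod h v))"
  by (rule dioph_rel3) (unfold cong_iff_lin_nat, intro dioph_intros)

section \<open>Exponentiation is Diophantine\<close>

definition pell :: "nat \<Rightarrow> nat \<Rightarrow> nat \<Rightarrow> nat \<Rightarrow> bool" where
  "pell a k x y \<longleftrightarrow> 2 \<le> a \<and> int x = px (int a) k \<and> int y = py (int a) k"

text \<open>\<open>py_characterisation\<close> over the natural numbers, with squares moved across
  to avoid subtraction. Index 0 is separate because that lemma assumes \<open>1 \<le> k\<close>; its
  assumption \<open>k \<le> y\<close> holds for every solution by \<open>py_ge\<close>.\<close>

lemma pell_iff:
  "pell a k x y \<longleftrightarrow> 2 \<le> a \<and> (k = 0 \<and> x = 1 \<and> y = 0 \<or>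
    1 \<le> k \<and> k \<le> y \<and> (\<exists>u v s t b. 1 \<le> v \<and> 2 \<le> b \<and>
      x * x + y * y = a * a * (y * y) + 1 \<and> u * u + v * v = a * a * (v * v) + 1 \<and>
      s * s + t * t = b * b * (t * t) + 1 \<and> y * y dvd v \<and> [b = 1] (mod 2 * y) \<and>
      [b = a] (mod u) \<and> [s = x] (mod u) \<and> [t = k] (mod 2 * y)))"
proof (cases "2 \<le> a \<and> k \<ge> 1")
  case False
  then have "a < 2 \<or> k = 0" by linarith
  then show ?thesis by (auto simp: pell_def)
next
  case True
  have eq: "(int p)^2 = ((int q)^2 - 1) * (int r)^2 + 1 \<longleftrightarrow> p * p + r * r = q * q * (r * r) + 1" for p q r
  proof -
    have "p * p + r * r = q * q * (r * r) + 1 \<longleftrightarrow>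
        int (p * p + r * r) = int (q * q * (r * r) + 1)" by presburger
    then show ?thesis by (simp add: power2_eq_square algebra_simps, linarith?)
  qed
  have ky: "k \<le> y" if "int y = py (int a) k" using py_ge[of "int a" k] that True by simp
  show ?thesis
  proof (cases "k \<le> y")
    case False
    then show ?thesis using True ky by (auto simp: pell_def)
  next
    case ky: True
    let ?Q = "\<lambda>u v s t b :: int. v > 0 \<and> b \<ge> 2 \<and>
      (int x)^2 = ((int a)^2 - 1) * (int y)^2 + 1 \<and> u^2 = ((int a)^2 - 1) * v^2 + 1 \<and>
      s^2 = (b^2 - 1) * t^2 + 1 \<and> (int y)^2 dvd v \<and> [b = 1] (mod 2 * int y) \<and>
      [b = int a] (mod u) \<and> [s = int x] (mod u) \<and> [t = int k] (mod 2 * int y)"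
    have "pell a k x y \<longleftrightarrow> (\<exists>u v s t b. u \<ge> 0 \<and> s \<ge> 0 \<and> t \<ge> 0 \<and> ?Q u v s t b)" (is "_ \<longleftrightarrow> ?E")
    proof -
      have "pell a k x y \<longleftrightarrow> int x = px (int a) (nat (int k)) \<and> int y = py (int a) (nat (int k))"
        using True by (simp add: pell_def)
      also have "\<dots> \<longleftrightarrow> ?E"
        by (subst py_characterisation) (use True ky in \<open>auto simp only: conj_ac\<close>)
      finally show ?thesis .
    qed
    also have "?E \<longleftrightarrow> (\<exists>u v s t b. ?Q (int u) (int v) (int s) (int t) (int b))" (is "_ \<longleftrightarrow> ?N")
    proof
      assume ?E
      then obtain u v s t b where *: "u \<ge> 0" "s \<ge> 0" "t \<ge> 0" "?Q u v s t b" by blast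
      then have "?Q (int (nat u)) (int (nat v)) (int (nat s)) (int (nat t)) (int (nat b))" by simp
      then show ?N by blast
    next
      assume ?N
      then show ?E by (metis of_nat_0_le_iff)
    qed
    also have "\<dots> \<longleftrightarrow> (\<exists>u v s t b. 1 \<le> v \<and> 2 \<le> b \<and>
      x * x + y * y = a * a * (y * y) + 1 \<and> u * u + v * v = a * a * (v * v) + 1 \<and>
      s * s + t * t = b * b * (t * t) + 1 \<and> y * y dvd v \<and> [b = 1] (mod 2 * y) \<and>
      [b = a] (mod u) \<and> [s = x] (mod u) \<and> [t = k] (mod 2 * y))"
    proof -
      have "int y ^ 2 dvd int v \<longleftrightarrow> y * y dvd v" for v
        by (metis of_nat_dvd_iff of_nat_mult power2_eq_square)
      moreover have "[int p = int q] (mod 2 * int r) \<longleftrightarrow> [p = q] (mod 2 * r)" for p q r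
        by (metis cong_int_iff of_nat_mult of_nat_numeral)
      moreover have "[int p = 1] (mod 2 * int r) \<longleftrightarrow> [p = 1] (mod 2 * r)" for p r
        by (metis cong_int_iff of_nat_mult of_nat_numeral of_nat_1)
      ultimately show ?thesis unfolding eq by (simp add: cong_int_iff Suc_le_eq)
    qed
    finally show ?thesis using True ky by simp
  qed
qed

lemma dioph_pell [dioph_intros]:
  "dfun f \<Longrightarrow> dfun g \<Longrightarrow> dfun h \<Longrightarrow> dfun k \<Longrightarrow> dioph (\<lambda>v. pell (f v) (g v) (h v) (k v))"
  by (rule dioph_rel4) (unfold pell_iff, intro dioph_intros)

text \<open>By \<open>pell_power_cong\<close>, the solution of index \<open>k\<close> for the base a
  = c + n + 2 yields n^k modulo t. The first Pell pair makes the base large: c is at least (n +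
  2)^k, so t exceeds n^k and the residue is the power itself.\<close>

lemma power_iff_pell:
  assumes "n \<ge> 1"
  shows "m = n ^ k \<longleftrightarrow> (\<exists>c d x y t. pell (n + 2) k c d \<and> pell (c + n + 2) k x y \<and>
    t + n * n + 1 = 2 * (c + n + 2) * n \<and> m < t \<and> [x + n * y = m + (c + n + 2) * y] (mod t))"
    (is "_ \<longleftrightarrow> ?R")
proof -
  define c d where "c = nat (px (int (n + 2)) k)" and "d = nat (py (int (n + 2)) k)"
  have 1: "pell (n + 2) k c' d' \<longleftrightarrow> c' = c \<and> d' = d" for c' d'
    using px_pos[of "int (n + 2)" k] py_nonneg[of "int (n + 2)" k]
    unfolding pell_def c_def d_def by auto
  define a where "a = c + n + 2"
  define x y where "x = nat (px (int a) k)" and "y = nat (py (int a) k)"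
  have xy: "int x = px (int a) k" "int y = py (int a) k"
    using px_pos[of "int a" k] py_nonneg[of "int a" k] unfolding x_def y_def a_def by auto
  then have 2: "pell a k x' y' \<longleftrightarrow> x' = x \<and> y' = y" for x' y'
    unfolding pell_def by (auto simp: a_def)
  define t where "t = 2 * a * n - n * n - 1"
  \<comment> \<open>Of the two copies of \<open>a * n\<close> in \<open>2 * a * n\<close>, one
    covers \<open>n * n + 1\<close> and the other is at least \<open>a\<close>.\<close>
  have "a * 1 \<le> a * n" using assms by (intro mult_le_mono) auto
  moreover have "(n + 1) * n \<le> a * n" by (intro mult_le_mono) (simp_all add: a_def)
  moreover have "2 * a * n = a * n + a * n" by simp
  moreover have "n * n + 1 \<le> (n + 1) * n" using assms by simp
  ultimately have at: "t + n * n + 1 = 2 * a * n" "a \<le> t"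
    unfolding t_def by linarith+
  have "int (n + 2) ^ k \<le> px (int (n + 2)) k" by (rule px_ge_power) simp
  then have "int ((n + 2) ^ k) \<le> int c" by (simp add: c_def)
  then have "(n + 2) ^ k \<le> c" by linarith
  then have "n ^ k < a" using power_mono[of n "n + 2" k] by (simp add: a_def)
  then have nk: "n ^ k < t" using at by simp
  have "int t = 2 * int a * int n - (int n)^2 - 1"
    using arg_cong[OF at(1), of int] by (simp add: power2_eq_square)
  then have "[int x - (int a - int n) * int y = int n ^ k] (mod int t)"
    using pell_power_cong[of "int a" k "int n"] xy by (simp add: a_def)
  then have "[int x - (int a - int n) * int y + int a * int y = int n ^ k + int a * int y] (mod int t)"
    by (intro cong_add cong_refl)
  moreover have "int x - (int a - int n) * int y + int a * int y = int (x + n * y)"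
    by (simp add: algebra_simps)
  moreover have "int n ^ k + int a * int y = int (n ^ k + a * y)" by simp
  ultimately have "[x + n * y = n ^ k + a * y] (mod t)" by (simp only: cong_int_iff)
  then have "[x + n * y = m + a * y] (mod t) \<longleftrightarrow> [m + a * y = n ^ k + a * y] (mod t)"
    by (meson cong_sym cong_trans)
  also have "\<dots> \<longleftrightarrow> [m = n ^ k] (mod t)" by (rule cong_add_rcancel_nat)
  finally have 3: "m < t \<and> [x + n * y = m + a * y] (mod t) \<longleftrightarrow> m = n ^ k"
    using nk by (auto dest: cong_less_modulus_unique_nat)
  have t: "t' + n * n + 1 = 2 * a * n \<longleftrightarrow> t' = t" for t' using at(1) by auto
  show ?thesis
    unfolding 1 using 2 3 t by (auto simp: a_def)
qed

text \<open>The successor keeps the base positive, as \<open>power_iff_pell\<close> demands, and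
  fits bases of the form \<open>B + 1\<close>.\<close>

definition is_power :: "nat \<Rightarrow> nat \<Rightarrow> nat \<Rightarrow> bool" where
  "is_power m n k \<longleftrightarrow> m = Suc n ^ k"

lemma dioph_is_power [dioph_intros]:
  "dfun f \<Longrightarrow> dfun g \<Longrightarrow> dfun h \<Longrightarrow> dioph (\<lambda>v. is_power (f v) (g v) (h v))"
  by (rule dioph_rel3) (unfold is_power_def, subst power_iff_pell, simp, intro dioph_intros)

section \<open>The bitwise order and binomial coefficients\<close>

definition bits_le :: "nat \<Rightarrow> nat \<Rightarrow> bool" where
  "bits_le x y \<longleftrightarrow> (\<forall>i. bit x i \<longrightarrow> bit y i)"

lemma bits_le_rec: "bits_le x y \<longleftrightarrow> (odd x \<longrightarrow> odd y) \<and> bits_le (x div 2) (y div 2)"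
proof
  assume "bits_le x y"
  then have *: "bit x i \<longrightarrow> bit y i" for i by (auto simp: bits_le_def)
  show "(odd x \<longrightarrow> odd y) \<and> bits_le (x div 2) (y div 2)"
    unfolding bits_le_def bit_Suc[symmetric] using * *[of 0] by (auto simp: bit_0)
next
  assume *: "(odd x \<longrightarrow> odd y) \<and> bits_le (x div 2) (y div 2)"
  show "bits_le x y" unfolding bits_le_def
  proof
    fix i show "bit x i \<longrightarrow> bit y i"
      using * by (cases i) (auto simp: bits_le_def bit_0 bit_Suc)
  qed
qed

lemma bits_le_0 [simp]: "bits_le x 0 \<longleftrightarrow> x = 0"
  by (auto simp: bits_le_def bit_eq_iff)

lemma bits_le_mask: "bits_le x (2 ^ q - 1) \<longleftrightarrow> x < 2 ^ q"
proof -
  have "bits_le x (2 ^ q - 1) \<longleftrightarrow> take_bit q x = x"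
    unfolding bits_le_def bit_eq_iff mask_eq_exp_minus_1[symmetric] bit_mask_iff bit_take_bit_iff
    by auto
  then show ?thesis by (simp add: take_bit_nat_eq_self_iff)
qed

lemma bits_le_1: "bits_le x (Suc 0) \<longleftrightarrow> x \<le> 1"
  using bits_le_mask[of x 1] by auto

lemma bit_block:
  fixes e :: nat
  assumes "e < 2 ^ b"
  shows "bit (e + 2 ^ b * y) i \<longleftrightarrow> (if i < b then bit e i else bit y (i - b))"
proof -
  have "take_bit b (e + 2 ^ b * y) = e" "drop_bit b (e + 2 ^ b * y) = y"
    using assms by (simp_all add: take_bit_eq_mod drop_bit_eq_div)
  then show ?thesis by (metis bit_drop_bit_eq bit_take_bit_iff comp_apply le_add_diff_inverse not_le)
qed

lemma bits_le_block:
  assumes "e < 2 ^ b"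
  shows "bits_le x (e + 2 ^ b * y) \<longleftrightarrow> bits_le (x mod 2 ^ b) e \<and> bits_le (x div 2 ^ b) y"
proof -
  have x: "x = x mod 2 ^ b + 2 ^ b * (x div 2 ^ b)" by simp
  have l: "x mod 2 ^ b < 2 ^ b" by simp
  have *: "bit x i \<longleftrightarrow> (if i < b then bit (x mod 2 ^ b) i else bit (x div 2 ^ b) (i - b))" for i
    by (subst x, rule bit_block[OF l])
  have **: "\<not> bit (x mod 2 ^ b) i" if "i \<ge> b" for i
    using that by (simp add: take_bit_eq_mod[symmetric] bit_take_bit_iff)
  show ?thesis
    unfolding bits_le_def * bit_block[OF assms]
    by (metis ** add_diff_cancel_left' le_add1 not_le)
qed

text \<open>Modulo 2, (1 + X)^(2n) equals (1 + X^2)^n. The induction applies Pascal's rule twice,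
  which makes the middle term even.\<close>

lemma odd_choose_double: "odd ((2 * n) choose k) \<longleftrightarrow> even k \<and> odd (n choose (k div 2))"
proof (induction n arbitrary: k)
  case 0
  show ?case
  proof (cases "k div 2")
    case 0
    then have "k = 0 \<or> k = 1" by linarith
    then show ?thesis by auto
  next
    case (Suc j)
    then have "k \<noteq> 0" by auto
    then show ?thesis using Suc by (simp add: binomial_eq_0)
  qed
next
  case (Suc n)
  consider "k = 0" | "k = 1" | j where "k = Suc (Suc j)" by (metis One_nat_def old.nat.exhaust)
  then show ?case
  proof cases
    case 3
    then have "(2 * Suc n) choose k = ((2 * n) choose j) + 2 * ((2 * n) choose (Suc j)) + ((2 * n) choose k)"
      by simp
    then show ?thesis using Suc.IH[of j] Suc.IH[of k] 3 by auto
  qed simp_all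
qed

text \<open>One more factor 1 + X copies the coefficients at even positions to the odd ones.\<close>

lemma odd_choose_Suc_double: "odd (Suc (2 * n) choose k) \<longleftrightarrow> odd (n choose (k div 2))"
proof (cases k)
  case (Suc j)
  then have "Suc (2 * n) choose k = ((2 * n) choose j) + ((2 * n) choose Suc j)" by simp
  then show ?thesis
    using odd_choose_double[of n j] odd_choose_double[of n "Suc j"] Suc by auto
qed simp

text \<open>Lucas's theorem for the prime 2, obtained by removing the last bit of both
  numbers.\<close>

lemma lucas_2: "odd (n choose k) \<longleftrightarrow> bits_le k n"
proof (induction n arbitrary: k rule: less_induct)
  case (less n)
  show ?case
  proof (cases "n = 0")
    case True
    then show ?thesis by (cases k) auto
  next
    case False
    then have IH: "odd ((n div 2) choose j) \<longleftrightarrow> bits_le j (n div 2)" for j by (intro less) simp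
    show ?thesis
    proof (cases "even n")
      case True
      then have "n = 2 * (n div 2)" by simp
      then show ?thesis using odd_choose_double[of "n div 2" k] IH True bits_le_rec[of k n] by simp
    next
      case False
      then have "n = Suc (2 * (n div 2))" by simp
      then show ?thesis using odd_choose_Suc_double[of "n div 2" k] IH False bits_le_rec[of k n] by metis
    qed
  qed
qed

section \<open>Binomial coefficients as digits of a power\<close>

lemma digit_sum:
  fixes a :: "nat \<Rightarrow> nat"
  assumes "\<And>j. a j < u"
  shows "(\<Sum>j<N. a j * u ^ j) div u ^ k mod u = (if k < N then a k else 0)"
  using assms
proof (induction k arbitrary: a N)
  case (0 a N)
  then show ?case
  proof (cases N)
    case (Suc M)
    have "(\<Sum>j<N. a j * u ^ j) = a 0 + u * (\<Sum>j<M. a (Suc j) * u ^ j)"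
      unfolding Suc sum.lessThan_Suc_shift by (simp add: sum_distrib_left algebra_simps)
    then show ?thesis using 0[of 0] Suc by simp
  qed simp
next
  case (Suc k a N)
  show ?case
  proof (cases N)
    case (Suc M)
    have "(\<Sum>j<N. a j * u ^ j) = a 0 + u * (\<Sum>j<M. a (Suc j) * u ^ j)"
      unfolding Suc sum.lessThan_Suc_shift by (simp add: sum_distrib_left algebra_simps)
    then have "(\<Sum>j<N. a j * u ^ j) div u = (\<Sum>j<M. a (Suc j) * u ^ j)"
      using Suc.prems[of 0] by simp
    then show ?thesis using Suc.IH[of "\<lambda>j. a (Suc j)" M] Suc.prems Suc
      by (simp add: div_mult2_eq)
  qed simp
qed

text \<open>Expand (u + 1)^n in powers of u: the coefficients are at most 2^n, so no carries occur
  in base u.\<close>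

lemma binomial_eq_digit:
  assumes "2 ^ n < u"
  shows "n choose k = (Suc u ^ n) div u ^ k mod u"
proof -
  have "Suc u ^ n = (\<Sum>j<Suc n. (n choose j) * u ^ j)"
    using binomial[of u 1 n] by (simp add: lessThan_Suc_atMost)
  moreover have "(n choose j) < u" for j
    using binomial_le_pow2[of n j] assms by linarith
  ultimately show ?thesis
    using digit_sum[of "\<lambda>j. n choose j" u "Suc n" k] by (simp add: binomial_eq_0)
qed

lemma odd_digit_iff:
  fixes p w u :: nat
  assumes "w > 0" "u > 0"
  shows "odd (p div w mod u) \<longleftrightarrow>
    (\<exists>q d c m. p = q * w + d \<and> d < w \<and> q = c * u + m \<and> m < u \<and> odd m)" (is "_ \<longleftrightarrow> ?R")
proof
  assume "odd (p div w mod u)"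
  then show ?R using assms
    by - (rule exI[of _ "p div w"], rule exI[of _ "p mod w"],
        rule exI[of _ "p div w div u"], rule exI[of _ "p div w mod u"], simp)
next
  assume ?R
  then obtain q d c m where *: "p = q * w + d" "d < w" "q = c * u + m" "m < u" "odd m"
    by blast
  have "p div w = q" using *(1,2) by simp
  moreover have "q mod u = m" using *(3,4) by simp
  ultimately show "odd (p div w mod u)" using *(5) by simp
qed

text \<open>The base u + 1 is 2^(n + 1), which suffices for \<open>binomial_eq_digit\<close>. Then p
  is (u + 2)^n, w cuts off its lowest k digits, and m is the binomial coefficient.\<close>

lemma bits_le_iff_power:
  "bits_le k n \<longleftrightarrow> (\<exists>u p w q d c m. is_power (u + 1) 1 (n + 1) \<and> is_power p (u + 1) n \<and>
    is_power w u k \<and> p = q * w + d \<and> d < w \<and> q = c * (u + 1) + m \<and> m < u + 1 \<and> odd m)"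
proof -
  define u :: nat where "u = 2 ^ Suc n - 1"
  have u: "Suc u = 2 ^ Suc n" by (simp add: u_def)
  have "bits_le k n \<longleftrightarrow> odd ((Suc (Suc u) ^ n) div Suc u ^ k mod Suc u)"
    unfolding lucas_2[symmetric] by (subst binomial_eq_digit[of n "Suc u"]) (simp_all add: u)
  also have "\<dots> \<longleftrightarrow> (\<exists>q d c m. Suc (Suc u) ^ n = q * Suc u ^ k + d \<and> d < Suc u ^ k \<and>
      q = c * Suc u + m \<and> m < Suc u \<and> odd m)" (is "_ \<longleftrightarrow> ?R")
    by (rule odd_digit_iff) simp_all
  finally have *: "bits_le k n \<longleftrightarrow> ?R" .
  have two: "Suc 1 = (2 :: nat)" by simp
  have "is_power (u' + 1) 1 (n + 1) \<longleftrightarrow> u' = u" for u'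
    unfolding is_power_def two using u by auto
  then show ?thesis unfolding * by (simp add: is_power_def)
qed

lemma dioph_bits_le [dioph_intros]: "dfun f \<Longrightarrow> dfun g \<Longrightarrow> dioph (\<lambda>v. bits_le (f v) (g v))"
  by (rule dioph_rel2) (unfold bits_le_iff_power, intro dioph_intros)

section \<open>Register systems\<close>

lemma mod_div_block:
  fixes x y z w b :: nat
  assumes "x < b" "z < b"
  shows "x + b * y = z + b * w \<longleftrightarrow> x = z \<and> y = w"
proof
  assume *: "x + b * y = z + b * w"
  then have "(x + b * y) mod b = (z + b * w) mod b" "(x + b * y) div b = (z + b * w) div b" by simp_all
  then show "x = z \<and> y = w" using assms by simp
qed simp

text \<open>
  A rule gives four coefficients for each register; it rewrites the value $\alpha y + \beta$ of a
  register to $\gamma y + \delta$, where $y$ may depend on the register.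
\<close>

type_synonym rules = "nat \<Rightarrow> nat \<Rightarrow> nat \<times> nat \<times> nat \<times> nat"

context
  fixes m k :: nat and R :: rules
begin

definition al :: "nat \<Rightarrow> nat \<Rightarrow> nat" where "al \<rho> j = fst (R \<rho> j)"
definition be :: "nat \<Rightarrow> nat \<Rightarrow> nat" where "be \<rho> j = fst (snd (R \<rho> j))"
definition ga :: "nat \<Rightarrow> nat \<Rightarrow> nat" where "ga \<rho> j = fst (snd (snd (R \<rho> j)))"
definition de :: "nat \<Rightarrow> nat \<Rightarrow> nat" where "de \<rho> j = snd (snd (snd (R \<rho> j)))"

definition rstep :: "(nat \<Rightarrow> nat) \<Rightarrow> (nat \<Rightarrow> nat) \<Rightarrow> bool" where
  "rstep r r' \<longleftrightarrow> (\<exists>\<rho><m. \<exists>y. \<forall>j<k. r j = al \<rho> j * y j + be \<rho> j \<and> r' j = ga \<rho> j * y j + de \<rho> j)"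

primrec rrun :: "nat \<Rightarrow> (nat \<Rightarrow> nat) \<Rightarrow> (nat \<Rightarrow> nat) \<Rightarrow> bool" where
  "rrun 0 r r' \<longleftrightarrow> (\<forall>j<k. r j = r' j)"
| "rrun (Suc T) r r' \<longleftrightarrow> (\<exists>r1. rstep r r1 \<and> rrun T r1 r')"

text \<open>
  A run of length \<open>T\<close> is packed into numbers in base \<open>B + 1\<close>: the digits of
  \<open>E \<rho>\<close> are 1 at the times at which rule \<open>\<rho>\<close> is applied and 0 elsewhere,
  and those of \<open>Y \<rho> j\<close> are the values $y_j$ at these times. The number \<open>I\<close>
  has all digits 1, and $P = (B + 1)^T$. The last equation compares the register contents before
  each step with those after the preceding one, which are shifted by one digit.
\<close>

definition packing :: "nat \<Rightarrow> nat \<Rightarrow> nat \<Rightarrow> (nat \<Rightarrow> nat) \<Rightarrow> (nat \<Rightarrow> nat) \<Rightarrow>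
    nat \<Rightarrow> (nat \<Rightarrow> nat) \<Rightarrow> (nat \<Rightarrow> nat \<Rightarrow> nat) \<Rightarrow> bool" where
  "packing Q B P r r' I E Y \<longleftrightarrow>
     I * B + 1 = P \<and> (\<forall>j<k. r j < B + 1) \<and> (\<forall>\<rho><m. bits_le (E \<rho>) I) \<and> (\<Sum>\<rho><m. E \<rho>) = I \<and>
     (\<forall>\<rho><m. \<forall>j<k. bits_le (Y \<rho> j) (Q * E \<rho>)) \<and>
     (\<forall>j<k. (\<Sum>\<rho><m. al \<rho> j * Y \<rho> j + be \<rho> j * E \<rho>) + P * r' j =
        r j + (B + 1) * (\<Sum>\<rho><m. ga \<rho> j * Y \<rho> j + de \<rho> j * E \<rho>))"

text \<open>The mask 2^q - 1, multiplied by an indicator, limits a digit of \<open>Y\<close> to q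
  bits when its rule is applied and to 0 otherwise. The base 2^b is larger, to leave room for affine
  combinations of such digits.\<close>

definition packed :: "nat \<Rightarrow> nat \<Rightarrow> nat \<Rightarrow> (nat \<Rightarrow> nat) \<Rightarrow> (nat \<Rightarrow> nat) \<Rightarrow> bool" where
  "packed q b T r r' \<longleftrightarrow> (\<exists>I E Y. packing (2 ^ q - 1) (2 ^ b - 1) ((2 ^ b) ^ T) r r' I E Y)"

text \<open>Chosen against carries: m + 2 covers a sum of m indicators, and the double sum covers
  \<alpha> y + \<beta> and \<gamma> y + \<delta> for every y below 2^q.\<close>

definition cbound :: nat where
  "cbound = m + 2 + (\<Sum>j<k. \<Sum>\<rho><m. al \<rho> j + be \<rho> j + ga \<rho> j + de \<rho> j)"

lemma cbound:
  assumes "\<rho> < m" "j < k"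
  shows "al \<rho> j + be \<rho> j < cbound" "ga \<rho> j + de \<rho> j < cbound"
proof -
  have "al \<rho> j + be \<rho> j + ga \<rho> j + de \<rho> j \<le> (\<Sum>\<rho><m. al \<rho> j + be \<rho> j + ga \<rho> j + de \<rho> j)"
    using assms by (intro member_le_sum[of \<rho> _ "\<lambda>\<rho>. al \<rho> j + be \<rho> j + ga \<rho> j + de \<rho> j"]) auto
  also have "\<dots> \<le> (\<Sum>j<k. \<Sum>\<rho><m. al \<rho> j + be \<rho> j + ga \<rho> j + de \<rho> j)"
    using assms
    by (intro member_le_sum[of j _ "\<lambda>j. \<Sum>\<rho><m. al \<rho> j + be \<rho> j + ga \<rho> j + de \<rho> j"]) auto
  finally show "al \<rho> j + be \<rho> j < cbound" "ga \<rho> j + de \<rho> j < cbound"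
    by (simp_all add: cbound_def)
qed

section \<open>Packings and runs compared one digit at a time\<close>

context
  fixes q b :: nat
  assumes qb: "cbound * 2 ^ q \<le> 2 ^ b"
begin

lemma block_gt: "m + 2 \<le> 2 ^ b"
proof -
  have "(m + 2) * 1 \<le> cbound * 2 ^ q" by (intro mult_le_mono) (auto simp: cbound_def)
  from order_trans[OF this qb] show ?thesis by simp
qed

lemma affine_less:
  assumes "y < 2 ^ q" "c + d < cbound"
  shows "c * y + d < 2 ^ b"
proof -
  have "c * y + d * 1 \<le> c * 2 ^ q + d * 2 ^ q"
    using assms(1) by (intro add_mono mult_le_mono) auto
  also have "\<dots> = (c + d) * 2 ^ q" by (simp add: algebra_simps)
  also have "\<dots> < cbound * 2 ^ q" using assms(2) by simp
  finally show ?thesis using order_less_le_trans[OF _ qb] by simp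
qed

lemma packed_0: "packed q b 0 r r' \<longleftrightarrow> (\<forall>j<k. r j = r' j \<and> r j < 2 ^ b)"
proof
  assume "packed q b 0 r r'"
  then obtain I E Y where *: "packing (2 ^ q - 1) (2 ^ b - 1) 1 r r' I E Y"
    by (auto simp: packed_def)
  then have I: "I = 0" using block_gt by (simp add: packing_def)
  then have E: "E \<rho> = 0" if "\<rho> < m" for \<rho> using * that by (simp add: packing_def)
  then have "Y \<rho> j = 0" if "\<rho> < m" "j < k" for \<rho> j using * that by (simp add: packing_def)
  then show "\<forall>j<k. r j = r' j \<and> r j < 2 ^ b" using * E by (simp add: packing_def)
next
  assume "\<forall>j<k. r j = r' j \<and> r j < 2 ^ b"
  then have "packing (2 ^ q - 1) (2 ^ b - 1) 1 r r' 0 (\<lambda>_. 0) (\<lambda>_ _. 0)"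
    by (auto simp: packing_def)
  then show "packed q b 0 r r'" unfolding packed_def by auto
qed

lemma repunit_block:
  assumes "I * (2 ^ b - 1) + 1 = ((2::nat) ^ b) ^ Suc T"
  obtains I' where "I = 1 + 2 ^ b * I'" "I' * (2 ^ b - 1) + 1 = (2 ^ b) ^ T"
proof -
  obtain B where B: "(2::nat) ^ b = Suc B" "B > 0" using block_gt by (cases "(2::nat) ^ b") auto
  have *: "I * B + 1 = Suc B * Suc B ^ T" using assms by (simp add: B)
  then have "1 + Suc B * I = I + Suc B * Suc B ^ T" by (simp add: algebra_simps)
  then have "(1 + Suc B * I) mod Suc B = (I + Suc B * Suc B ^ T) mod Suc B" by (simp only:)
  then have "I mod Suc B = 1" using B(2) by (simp only: mod_mult_self2) simp
  then have I: "I = 1 + Suc B * (I div Suc B)" by (metis add.commute mult_div_mod_eq)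
  have "Suc B * ((I div Suc B) * B + 1) = Suc B * Suc B ^ T"
    using * by (subst (asm) I) (simp add: algebra_simps)
  then have "(I div Suc B) * B + 1 = Suc B ^ T" by (metis Suc_neq_Zero mult_cancel1)
  then show thesis using that[of "I div Suc B"] I by (simp add: B)
qed

text \<open>The lowest digits describe the first step, the higher ones a packing of the remaining
  run. As nothing overflows, each condition splits into these two parts.\<close>

lemma packing_SucD:
  assumes "packing (2 ^ q - 1) (2 ^ b - 1) ((2 ^ b) ^ Suc T) r r' I E Y"
  shows "\<exists>\<rho><m. \<exists>y. (\<forall>j<k. y j < 2 ^ q \<and> r j = al \<rho> j * y j + be \<rho> j) \<and>
    packed q b T (\<lambda>j. ga \<rho> j * y j + de \<rho> j) r'"
proof -
  define B where "B = (2::nat) ^ b"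
  have B2: "m + 2 \<le> B" unfolding B_def by (rule block_gt)
  have B1: "2 ^ b - 1 + 1 = B" using B2 by (simp add: B_def)
  from assms have I: "I * (2 ^ b - 1) + 1 = (2 ^ b) ^ Suc T"
    and r: "\<And>j. j < k \<Longrightarrow> r j < B" and E: "\<And>\<rho>. \<rho> < m \<Longrightarrow> bits_le (E \<rho>) I"
    and sumE: "(\<Sum>\<rho><m. E \<rho>) = I"
    and Y: "\<And>\<rho> j. \<rho> < m \<Longrightarrow> j < k \<Longrightarrow> bits_le (Y \<rho> j) ((2 ^ q - 1) * E \<rho>)"
    and eq: "\<And>j. j < k \<Longrightarrow> (\<Sum>\<rho><m. al \<rho> j * Y \<rho> j + be \<rho> j * E \<rho>) + B ^ Suc T * r' j =
        r j + B * (\<Sum>\<rho><m. ga \<rho> j * Y \<rho> j + de \<rho> j * E \<rho>)"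
    unfolding packing_def B1 by (auto simp: B_def)
  obtain I' where I': "I = 1 + 2 ^ b * I'" "I' * (2 ^ b - 1) + 1 = (2 ^ b) ^ T"
    using repunit_block[OF I] .
  define e E' where "e \<rho> = E \<rho> mod B" and "E' \<rho> = E \<rho> div B" for \<rho>
  define y Y' where "y \<rho> j = Y \<rho> j mod B" and "Y' \<rho> j = Y \<rho> j div B" for \<rho> j
  have Ee: "E \<rho> = e \<rho> + B * E' \<rho>" for \<rho> by (simp add: e_def E'_def)
  have Yy: "Y \<rho> j = y \<rho> j + B * Y' \<rho> j" for \<rho> j by (simp add: y_def Y'_def)
  have e1: "e \<rho> \<le> 1" and E'1: "bits_le (E' \<rho>) I'" if "\<rho> < m" for \<rho>
    using E[OF that] B2 bits_le_block[of 1 b "E \<rho>" I'] unfolding I' e_def E'_def B_def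
    by (simp_all add: bits_le_1)
  \<comment> \<open>A sum of m indicators stays below the base and thus equals the lowest digit 1 of
    \<open>I\<close>: exactly one rule is applied.\<close>
  have "(\<Sum>\<rho><m. e \<rho>) \<le> (\<Sum>\<rho><m. 1)" by (intro sum_mono) (use e1 in auto)
  then have "(\<Sum>\<rho><m. e \<rho>) < B" using B2 by simp
  moreover have "(\<Sum>\<rho><m. e \<rho>) + B * (\<Sum>\<rho><m. E' \<rho>) = 1 + B * I'"
    using sumE I'(1) by (simp add: Ee sum.distrib sum_distrib_left B_def)
  ultimately have sume: "(\<Sum>\<rho><m. e \<rho>) = 1" and sumE': "(\<Sum>\<rho><m. E' \<rho>) = I'"
    using mod_div_block[of "\<Sum>\<rho><m. e \<rho>" B 1] B2 by auto
  obtain \<rho>0 where \<rho>0: "\<rho>0 < m" "e \<rho>0 = 1" "\<And>\<rho>. \<rho> < m \<Longrightarrow> \<rho> \<noteq> \<rho>0 \<Longrightarrow> e \<rho> = 0"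
    using sume sum_eq_1_iff[of "{..<m}" e] by auto
  have y1: "bits_le (y \<rho> j) ((2 ^ q - 1) * e \<rho>)" and Y'1: "bits_le (Y' \<rho> j) ((2 ^ q - 1) * E' \<rho>)"
    if "\<rho> < m" "j < k" for \<rho> j
  proof -
    have "(2 ^ q - 1) * 1 + 0 < (2::nat) ^ b"
      using affine_less[of "2 ^ q - 1" 1 0] by (simp add: cbound_def)
    then have "(2 ^ q - 1) * e \<rho> < 2 ^ b" using e1[OF that(1)] by (cases "e \<rho>") auto
    moreover have "(2 ^ q - 1) * E \<rho> = (2 ^ q - 1) * e \<rho> + 2 ^ b * ((2 ^ q - 1) * E' \<rho>)"
      by (simp add: Ee B_def algebra_simps)
    ultimately show "bits_le (y \<rho> j) ((2 ^ q - 1) * e \<rho>)" "bits_le (Y' \<rho> j) ((2 ^ q - 1) * E' \<rho>)"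
      using Y[OF that] bits_le_block unfolding y_def Y'_def B_def by simp_all
  qed
  have y0: "y \<rho> j = 0" if "\<rho> < m" "\<rho> \<noteq> \<rho>0" "j < k" for \<rho> j
    using y1[OF that(1,3)] \<rho>0(3)[OF that(1,2)] by simp
  have yq: "y \<rho>0 j < 2 ^ q" if "j < k" for j
    using y1[OF \<rho>0(1) that] \<rho>0(2) bits_le_mask by simp
  have one: "(\<Sum>\<rho><m. c \<rho> * Y \<rho> j + d \<rho> * E \<rho>) =
      (c \<rho>0 * y \<rho>0 j + d \<rho>0) + B * (\<Sum>\<rho><m. c \<rho> * Y' \<rho> j + d \<rho> * E' \<rho>)" if "j < k" for c d j
  proof -
    have "(\<Sum>\<rho><m. c \<rho> * y \<rho> j + d \<rho> * e \<rho>) = (\<Sum>\<rho>\<in>{\<rho>0}. c \<rho> * y \<rho> j + d \<rho> * e \<rho>)"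
      by (rule sum.mono_neutral_right) (use \<rho>0 y0 that in auto)
    then have "(\<Sum>\<rho><m. c \<rho> * y \<rho> j + d \<rho> * e \<rho>) = c \<rho>0 * y \<rho>0 j + d \<rho>0" using \<rho>0(2) by simp
    moreover have "(\<Sum>\<rho><m. c \<rho> * Y \<rho> j + d \<rho> * E \<rho>) = (\<Sum>\<rho><m. c \<rho> * y \<rho> j + d \<rho> * e \<rho>) +
        B * (\<Sum>\<rho><m. c \<rho> * Y' \<rho> j + d \<rho> * E' \<rho>)"
      unfolding Ee Yy sum_distrib_left sum.distrib[symmetric]
      by (intro sum.cong) (simp_all add: algebra_simps)
    ultimately show ?thesis by simp
  qed
  have step: "r j = al \<rho>0 j * y \<rho>0 j + be \<rho>0 j \<and>
    (\<Sum>\<rho><m. al \<rho> j * Y' \<rho> j + be \<rho> j * E' \<rho>) + B ^ T * r' j =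
      ga \<rho>0 j * y \<rho>0 j + de \<rho>0 j + B * (\<Sum>\<rho><m. ga \<rho> j * Y' \<rho> j + de \<rho> j * E' \<rho>)"
    if j: "j < k" for j
  proof -
    \<comment> \<open>With this bound the register equation splits: its lowest digit matches
      \<open>r j\<close>, and its higher digits form the equation of the remaining run.\<close>
    have "al \<rho>0 j * y \<rho>0 j + be \<rho>0 j < B"
      unfolding B_def by (rule affine_less[OF yq[OF j] cbound(1)[OF \<rho>0(1) j]])
    moreover have "al \<rho>0 j * y \<rho>0 j + be \<rho>0 j +
        B * ((\<Sum>\<rho><m. al \<rho> j * Y' \<rho> j + be \<rho> j * E' \<rho>) + B ^ T * r' j) =
      r j + B * (ga \<rho>0 j * y \<rho>0 j + de \<rho>0 j + B * (\<Sum>\<rho><m. ga \<rho> j * Y' \<rho> j + de \<rho> j * E' \<rho>))"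
      using eq[OF j] unfolding one[OF j] by (simp add: algebra_simps)
    ultimately show ?thesis using mod_div_block r[OF j] by auto
  qed
  have "packing (2 ^ q - 1) (2 ^ b - 1) ((2 ^ b) ^ T) (\<lambda>j. ga \<rho>0 j * y \<rho>0 j + de \<rho>0 j) r' I' E' Y'"
    unfolding packing_def B1 using I'(2) E'1 sumE' Y'1 step
      affine_less[OF yq cbound(2)[OF \<rho>0(1)]] by (auto simp: B_def)
  then have "packed q b T (\<lambda>j. ga \<rho>0 j * y \<rho>0 j + de \<rho>0 j) r'" unfolding packed_def by blast
  then show ?thesis using \<rho>0(1) yq step by blast
qed

text \<open>Shifting all packed numbers by one digit makes room for the first step, whose indicator
  is 1 for \<open>\<rho>0\<close> alone.\<close>

lemma packed_SucI:
  assumes \<rho>0: "\<rho>0 < m" and y: "\<And>j. j < k \<Longrightarrow> y j < 2 ^ q"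
    and r: "\<And>j. j < k \<Longrightarrow> r j = al \<rho>0 j * y j + be \<rho>0 j"
    and packed: "packed q b T (\<lambda>j. ga \<rho>0 j * y j + de \<rho>0 j) r'"
  shows "packed q b (Suc T) r r'"
proof -
  define B where "B = (2::nat) ^ b"
  have B2: "m + 2 \<le> B" unfolding B_def by (rule block_gt)
  have B1: "2 ^ b - 1 + 1 = B" using B2 by (simp add: B_def)
  from packed obtain I' E' Y' where packing:
    "packing (2 ^ q - 1) (2 ^ b - 1) ((2 ^ b) ^ T) (\<lambda>j. ga \<rho>0 j * y j + de \<rho>0 j) r' I' E' Y'"
    unfolding packed_def by blast
  then have I': "I' * (B - 1) + 1 = B ^ T"
    and E': "\<And>\<rho>. \<rho> < m \<Longrightarrow> bits_le (E' \<rho>) I'"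
    and sumE': "(\<Sum>\<rho><m. E' \<rho>) = I'"
    and Y': "\<And>\<rho> j. \<rho> < m \<Longrightarrow> j < k \<Longrightarrow> bits_le (Y' \<rho> j) ((2 ^ q - 1) * E' \<rho>)"
    and eq: "\<And>j. j < k \<Longrightarrow> (\<Sum>\<rho><m. al \<rho> j * Y' \<rho> j + be \<rho> j * E' \<rho>) + B ^ T * r' j =
        ga \<rho>0 j * y j + de \<rho>0 j + B * (\<Sum>\<rho><m. ga \<rho> j * Y' \<rho> j + de \<rho> j * E' \<rho>)"
    unfolding packing_def B1 by (auto simp: B_def)
  define e where "e \<rho> = (if \<rho> = \<rho>0 then 1 else 0 :: nat)" for \<rho>
  define z where "z \<rho> j = (if \<rho> = \<rho>0 then y j else 0)" for \<rho> j
  define E where "E \<rho> = e \<rho> + B * E' \<rho>" for \<rho>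
  define Y where "Y \<rho> j = z \<rho> j + B * Y' \<rho> j" for \<rho> j
  have qb1: "2 ^ q - 1 < B"
    using affine_less[of "2 ^ q - 1" 1 0] by (simp add: cbound_def B_def)
  have eB: "e \<rho> < B" for \<rho> using B2 by (simp add: e_def)
  have zB: "z \<rho> j < B" if "j < k" for \<rho> j using y[OF that] qb1 unfolding z_def by presburger
  have one: "(\<Sum>\<rho><m. c \<rho> * Y \<rho> j + d \<rho> * E \<rho>) =
      (c \<rho>0 * y j + d \<rho>0) + B * (\<Sum>\<rho><m. c \<rho> * Y' \<rho> j + d \<rho> * E' \<rho>)" for c d j
  proof -
    have "(\<Sum>\<rho><m. c \<rho> * z \<rho> j + d \<rho> * e \<rho>) = (\<Sum>\<rho>\<in>{\<rho>0}. c \<rho> * z \<rho> j + d \<rho> * e \<rho>)"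
      by (rule sum.mono_neutral_right) (use \<rho>0 in \<open>auto simp: z_def e_def\<close>)
    then have "(\<Sum>\<rho><m. c \<rho> * z \<rho> j + d \<rho> * e \<rho>) = c \<rho>0 * y j + d \<rho>0"
      by (simp add: z_def e_def)
    moreover have "(\<Sum>\<rho><m. c \<rho> * Y \<rho> j + d \<rho> * E \<rho>) = (\<Sum>\<rho><m. c \<rho> * z \<rho> j + d \<rho> * e \<rho>) +
        B * (\<Sum>\<rho><m. c \<rho> * Y' \<rho> j + d \<rho> * E' \<rho>)"
      unfolding E_def Y_def sum_distrib_left sum.distrib[symmetric]
      by (intro sum.cong) (simp_all add: algebra_simps)
    ultimately show ?thesis by simp
  qed
  have I: "(1 + B * I') * (B - 1) + 1 = B ^ Suc T"
  proof -
    obtain C where "B = Suc C" using B2 by (cases B) auto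
    then have "(1 + B * I') * (B - 1) + 1 = B * (I' * (B - 1) + 1)"
      by (simp add: algebra_simps)
    then show ?thesis by (simp only: I' power_Suc)
  qed
  have "bits_le (E \<rho>) (1 + B * I')" if "\<rho> < m" for \<rho>
    using E'[OF that] B2 bits_le_block[of 1 b "E \<rho>" I'] eB[of \<rho>]
    by (auto simp: E_def B_def bits_le_1 e_def)
  moreover have "(\<Sum>\<rho><m. E \<rho>) = 1 + B * I'"
  proof -
    have "(\<Sum>\<rho><m. e \<rho>) = 1" using \<rho>0 by (simp add: e_def)
    then show ?thesis using sumE' by (simp add: E_def sum.distrib sum_distrib_left[symmetric])
  qed
  moreover have "bits_le (Y \<rho> j) ((2 ^ q - 1) * E \<rho>)" if "\<rho> < m" "j < k" for \<rho> j
  proof -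
    have "(2 ^ q - 1) * e \<rho> < 2 ^ b" using qb1 by (simp add: e_def B_def)
    moreover have "(2 ^ q - 1) * E \<rho> = (2 ^ q - 1) * e \<rho> + 2 ^ b * ((2 ^ q - 1) * E' \<rho>)"
      by (simp add: E_def B_def algebra_simps)
    moreover have "bits_le (z \<rho> j) ((2 ^ q - 1) * e \<rho>)"
      using y[OF that(2)] by (simp add: z_def e_def bits_le_mask[unfolded One_nat_def])
    ultimately show ?thesis
      using Y'[OF that] zB[OF that(2), of \<rho>] bits_le_block by (simp add: Y_def B_def)
  qed
  moreover have "(\<Sum>\<rho><m. al \<rho> j * Y \<rho> j + be \<rho> j * E \<rho>) + B ^ Suc T * r' j =
        r j + B * (\<Sum>\<rho><m. ga \<rho> j * Y \<rho> j + de \<rho> j * E \<rho>)" if j: "j < k" for j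
    unfolding one r[OF j] eq[OF j, symmetric] by (simp add: algebra_simps)
  moreover have "r j < B" if j: "j < k" for j
    unfolding r[OF j] B_def by (rule affine_less[OF y[OF j] cbound(1)[OF \<rho>0 j]])
  ultimately have "packing (2 ^ q - 1) (2 ^ b - 1) ((2 ^ b) ^ Suc T) r r' (1 + B * I') E Y"
    using I unfolding packing_def B1 by (auto simp: B_def)
  then show ?thesis unfolding packed_def by blast
qed

lemma packed_imp_rrun: "packed q b T r r' \<Longrightarrow> rrun T r r'"
proof (induction T arbitrary: r)
  case 0
  then show ?case by (simp add: packed_0)
next
  case (Suc T)
  then obtain I E Y where "packing (2 ^ q - 1) (2 ^ b - 1) ((2 ^ b) ^ Suc T) r r' I E Y"
    unfolding packed_def by blast
  from packing_SucD[OF this] obtain \<rho> y where *: "\<rho> < m" "\<forall>j<k. r j = al \<rho> j * y j + be \<rho> j"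
    "packed q b T (\<lambda>j. ga \<rho> j * y j + de \<rho> j) r'" by blast
  have "rstep r (\<lambda>j. ga \<rho> j * y j + de \<rho> j)"
    unfolding rstep_def using * by (intro exI[of _ \<rho>] conjI exI[of _ y]) auto
  then show ?case using Suc.IH[OF *(3)] by auto
qed

end

lemma packed_cong: "(\<And>j. j < k \<Longrightarrow> r j = s j) \<Longrightarrow> packed q b T r r' \<longleftrightarrow> packed q b T s r'"
  by (simp add: packed_def packing_def)

text \<open>A finite run has bounded values. Asking for all larger q as well lets the induction
  raise the bound at each step.\<close>

lemma rrun_imp_packed:
  "rrun T r r' \<Longrightarrow> \<exists>q0. \<forall>q\<ge>q0. \<forall>b. cbound * 2 ^ q \<le> 2 ^ b \<longrightarrow> packed q b T r r'"
proof (induction T arbitrary: r)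
  case 0
  have "packed q b 0 r r'" if q: "q \<ge> (\<Sum>j<k. r j)" and b: "cbound * 2 ^ q \<le> 2 ^ b" for q b
  proof -
    have "r j < 2 ^ b" if j: "j < k" for j
    proof -
      have "r j \<le> (\<Sum>j<k. r j)" using j by (intro member_le_sum) auto
      then have "r j < 2 ^ q" using q less_exp[of q] by linarith
      also have "1 * 2 ^ q \<le> cbound * 2 ^ q" by (intro mult_le_mono) (auto simp: cbound_def)
      finally show ?thesis using b by linarith
    qed
    then show ?thesis using packed_0[OF b] 0 by simp
  qed
  then show ?case by blast
next
  case (Suc T)
  then obtain r1 where r1: "rstep r r1" "rrun T r1 r'" by auto
  from Suc.IH[OF r1(2)] obtain q0 where
    q0: "\<And>q b. q \<ge> q0 \<Longrightarrow> cbound * 2 ^ q \<le> 2 ^ b \<Longrightarrow> packed q b T r1 r'" by blast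
  from r1(1) obtain \<rho> y where \<rho>: "\<rho> < m"
    "\<And>j. j < k \<Longrightarrow> r j = al \<rho> j * y j + be \<rho> j" "\<And>j. j < k \<Longrightarrow> r1 j = ga \<rho> j * y j + de \<rho> j"
    unfolding rstep_def by blast
  have "packed q b (Suc T) r r'" if "q \<ge> q0 + (\<Sum>j<k. y j)" "cbound * 2 ^ q \<le> 2 ^ b" for q b
  proof (rule packed_SucI[OF that(2) \<rho>(1) _ \<rho>(2)])
    fix j assume "j < k"
    then have "y j \<le> (\<Sum>j<k. y j)" by (intro member_le_sum) auto
    then show "y j < 2 ^ q" using that(1) less_exp[of q] by linarith
  next
    have "packed q b T r1 r'" using q0 that by simp
    then show "packed q b T (\<lambda>j. ga \<rho> j * y j + de \<rho> j) r'"
      using packed_cong[of r1 "\<lambda>j. ga \<rho> j * y j + de \<rho> j"] \<rho>(3) by simp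
  qed
  then show ?case by blast
qed

lemma reach_iff_packed:
  "(\<exists>T. rrun T r r') \<longleftrightarrow> (\<exists>T q b Q B P I E Y. is_power (Q + 1) 1 q \<and> is_power (B + 1) 1 b \<and>
     is_power P B T \<and> cbound * (Q + 1) \<le> B + 1 \<and> packing Q B P r r' I E Y)"
  (is "_ \<longleftrightarrow> ?R")
proof
  assume "\<exists>T. rrun T r r'"
  then obtain T q where q: "\<forall>b. cbound * 2 ^ q \<le> 2 ^ b \<longrightarrow> packed q b T r r'"
    using rrun_imp_packed by blast
  \<comment> \<open>Since n < 2^n, this exponent makes the base large enough.\<close>
  define b where "b = cbound * 2 ^ q"
  have cb: "cbound * 2 ^ q \<le> 2 ^ b" unfolding b_def using less_exp less_imp_le by blast
  then obtain I E Y where "packing (2 ^ q - 1) (2 ^ b - 1) ((2 ^ b) ^ T) r r' I E Y"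
    using q unfolding packed_def by blast
  moreover have "is_power (2 ^ q - 1 + 1) 1 q" "is_power (2 ^ b - 1 + 1) 1 b"
    "is_power ((2 ^ b) ^ T) (2 ^ b - 1) T" "cbound * (2 ^ q - 1 + 1) \<le> 2 ^ b - 1 + 1"
    using cb by (simp_all add: is_power_def numeral_2_eq_2)
  ultimately show ?R by blast
next
  assume ?R
  then obtain T q b Q B P I E Y where *: "is_power (Q + 1) 1 q" "is_power (B + 1) 1 b"
     "is_power P B T" "cbound * (Q + 1) \<le> B + 1" "packing Q B P r r' I E Y" by blast
  have "Q + 1 = 2 ^ q" "B + 1 = 2 ^ b" using *(1,2) by (simp_all add: is_power_def numeral_2_eq_2)
  then have "Q = 2 ^ q - 1" "B = 2 ^ b - 1" "P = (2 ^ b) ^ T" "cbound * 2 ^ q \<le> 2 ^ b"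
    using *(3,4) by (simp_all add: is_power_def)
  then show "\<exists>T. rrun T r r'"
    using *(5) packed_imp_rrun unfolding packed_def by blast
qed

text \<open>The numbers of rules and registers and all coefficients are constants, so the
  quantifiers and sums over them in \<open>packing\<close> are finite; the length of the run is an
  unknown.\<close>

lemma dioph_reach:
  assumes "\<And>j. dfun (f j)" "\<And>j. dfun (g j)"
  shows "dioph (\<lambda>v. \<exists>T. rrun T (\<lambda>j. f j v) (\<lambda>j. g j v))"
proof -
  have base: "dioph (\<lambda>v. \<exists>T. rrun T (\<lambda>j. v (2 * j)) (\<lambda>j. v (Suc (2 * j))))"
    unfolding reach_iff_packed packing_def by (intro dioph_intros)
  let ?t = "\<lambda>i. if even i then f (i div 2) else g (i div 2)"
  have "dfun (?t i)" for i using assms by simp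
  from dioph_subst[OF base, of ?t, OF this] show ?thesis by simp
qed

end

section \<open>Turing machines as register systems\<close>

text \<open>The tape contents in base \<open>K\<close>, with the leftmost symbol as the lowest digit.\<close>

primrec push :: "nat \<Rightarrow> bool list \<Rightarrow> nat \<Rightarrow> nat" where
  "push K [] n = n"
| "push K (b # w) n = (if b then 2 else 1) + K * push K w n"

lemma push_append: "push K (u @ w) n = push K u (push K w n)"
  by (induction u) simp_all

lemma push_affine: "push K w n = push K w 0 + K ^ length w * n"
  by (induction w) (simp_all add: algebra_simps)

lemma push_digit:
  assumes "K \<ge> 3"
  shows "push K w 0 div K ^ i mod K = (if i < length w then (if w ! i then 2 else 1) else 0)"
  using assms
proof (induction w arbitrary: i)
  case (Cons b w)
  have "(if b then 2 else 1) < K" using Cons.prems by simp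
  then show ?case using Cons by (cases i) (simp_all add: div_mult2_eq)
qed simp

text \<open>The tape is cut at the head: \<open>r\<close> has the scanned symbol as lowest digit and
  continues to the right, \<open>l\<close> starts with the cell left of the head and continues to
  the left. The blank is the digit 0, so infinite blank tails fit into finite numbers.\<close>

fun nstep :: "tm \<Rightarrow> nat \<times> nat \<times> nat \<Rightarrow> nat \<times> nat \<times> nat" where
  "nstep M (q, l, r) =
    (if q = 1 \<or> q = 2 then (q, l, r)
     else let K = tm_symbols M in case tm_trans M q (r mod K) of (q', s', d) \<Rightarrow>
       (q', case d of Move_Left \<Rightarrow> (l div K, l mod K + K * (s' + K * (r div K)))
                    | Move_Right \<Rightarrow> (s' + K * l, r div K)))"

fun represents :: "nat \<Rightarrow> config \<Rightarrow> nat \<times> nat \<times> nat \<Rightarrow> bool" where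
  "represents K (q, tape, h) (q', l, r) \<longleftrightarrow> q = q' \<and>
     (\<forall>i. tape (h + int i) = r div K ^ i mod K) \<and> (\<forall>i. tape (h - 1 - int i) = l div K ^ i mod K)"

context
  fixes M :: tm
  assumes M: "turing_machine M"
begin

lemma symbols_ge_3: "3 \<le> tm_symbols M" and states_ge_3: "3 \<le> tm_states M"
  using M by (auto simp: turing_machine_def)

lemma trans_less:
  assumes "tm_trans M q s = (q', s', d)" "q < tm_states M" "s < tm_symbols M"
  shows "q' < tm_states M" "s' < tm_symbols M"
  using M assms unfolding turing_machine_def by blast+

lemma nstep_state: "fst x < tm_states M \<Longrightarrow> fst (nstep M x) < tm_states M"
  using trans_less symbols_ge_3 by (cases x) (auto simp: Let_def split: prod.splits)

lemma represents_step:
  assumes "represents (tm_symbols M) c x" "fst x < tm_states M"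
  shows "represents (tm_symbols M) (tm_step M c) (nstep M x)"
proof -
  define K where "K = tm_symbols M"
  have K: "K > 0" using symbols_ge_3 by (simp add: K_def)
  obtain q tape h where c: "c = (q, tape, h)" by (cases c)
  obtain l r where x: "x = (q, l, r)" using assms c by (cases x) auto
  have r: "tape (h + int i) = r div K ^ i mod K" for i using assms by (simp add: c x K_def)
  have l: "tape (h - 1 - int i) = l div K ^ i mod K" for i using assms by (simp add: c x K_def)
  show ?thesis
  proof (cases "q = 1 \<or> q = 2")
    case True
    then show ?thesis using assms by (auto simp: c x)
  next
    case False
    have t0: "tape h = r mod K" using r[of 0] by simp
    obtain q' s' d where tr: "tm_trans M q (r mod K) = (q', s', d)" by (metis prod_cases3)
    then have s': "s' < K" using trans_less[OF tr] assms K by (simp add: x K_def)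
    have low: "(a + K * y) div K ^ Suc i mod K = y div K ^ i mod K" if "a < K" for a y i
      using that K by (simp add: div_mult2_eq)
    show ?thesis
    proof (cases d)
      case Move_Left
      \<comment> \<open>Position 0 is the cell taken from \<open>l\<close>, position 1 the symbol
        just written; the later ones come from \<open>r\<close>.\<close>
      have "(tape(h := s')) (h - 1 + int i) =
          (l mod K + K * (s' + K * (r div K))) div K ^ i mod K" for i
      proof (cases i)
        case 0
        then show ?thesis using l[of 0] K by simp
      next
        case (Suc j)
        then show ?thesis
        proof (cases j)
          case 0
          then show ?thesis using Suc low[of "l mod K" _ 0] K s' by simp
        next
          case Suc': (Suc i')
          have eq: "h - 1 + int i = h + int (Suc i')" by (simp add: Suc Suc')
          have "(tape(h := s')) (h - 1 + int i) = r div K ^ Suc i' mod K"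
            unfolding eq using r[of "Suc i'"] by (simp del: of_nat_Suc power_Suc)
          then show ?thesis using low[of "l mod K" _ j] low[OF s', of _ i'] K
            unfolding Suc Suc' by (simp add: div_mult2_eq)
        qed
      qed
      moreover have "(tape(h := s')) (h - 1 - 1 - int i) = l div K div K ^ i mod K" for i
      proof -
        have eq: "h - 1 - 1 - int i = h - 1 - int (Suc i)" and "h - 1 - int (Suc i) \<noteq> h" by simp_all
        then show ?thesis unfolding eq using l[of "Suc i"] by (simp add: div_mult2_eq del: of_nat_Suc)
      qed
      ultimately show ?thesis using False t0 tr Move_Left by (simp add: c x K_def[symmetric] Let_def)
    next
      case Move_Right
      have "(tape(h := s')) (h + 1 + int i) = r div K div K ^ i mod K" for i
      proof -
        have eq: "h + 1 + int i = h + int (Suc i)" and "h + int (Suc i) \<noteq> h" by simp_all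
        then show ?thesis unfolding eq using r[of "Suc i"] by (simp add: div_mult2_eq del: of_nat_Suc)
      qed
      moreover have "(tape(h := s')) (h + 1 - 1 - int i) = (s' + K * l) div K ^ i mod K" for i
      proof (cases i)
        case 0
        then show ?thesis using s' by simp
      next
        case (Suc j)
        have eq: "h + 1 - 1 - int i = h - 1 - int j" and "h - 1 - int j \<noteq> h" by (simp_all add: Suc)
        then show ?thesis unfolding eq using l[of j] low[OF s', of l j] Suc by (simp del: power_Suc)
      qed
      ultimately show ?thesis using False t0 tr Move_Right by (simp add: c x K_def[symmetric] Let_def)
    qed
  qed
qed

lemma represents_steps:
  assumes "represents (tm_symbols M) c x" "fst x < tm_states M"
  shows "represents (tm_symbols M) ((tm_step M ^^ t) c) ((nstep M ^^ t) x)
    \<and> fst ((nstep M ^^ t) x) < tm_states M"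
proof (induction t)
  case (Suc t)
  then show ?case using represents_step nstep_state by simp
qed (use assms in simp)

lemma represents_init: "represents (tm_symbols M) (tm_init w) (0, 0, push (tm_symbols M) w 0)"
  by (auto simp: tm_init_def push_digit[OF symbols_ge_3])

lemma rejects_iff_nstep:
  "tm_rejects M w \<longleftrightarrow> (\<exists>t. fst ((nstep M ^^ t) (0, 0, push (tm_symbols M) w 0)) = 2)"
proof -
  have "fst ((tm_step M ^^ t) (tm_init w)) = fst ((nstep M ^^ t) (0, 0, push (tm_symbols M) w 0))" for t
    using represents_steps[OF represents_init, of w t] states_ge_3
    by (cases "(tm_step M ^^ t) (tm_init w)"; cases "(nstep M ^^ t) (0, 0, push (tm_symbols M) w 0)") auto
  then show ?thesis by (simp add: tm_rejects_def)
qed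

text \<open>A rule guesses the state q, the scanned symbol s and the symbol t left of the head. The
  match with K y + s and K y + t verifies the guess. Halting states get identity rules in agreement
  with \<open>nstep\<close>.\<close>

definition tm_rule :: "nat \<times> nat \<times> nat \<Rightarrow> nat \<Rightarrow> nat \<times> nat \<times> nat \<times> nat" where
  "tm_rule = (\<lambda>(q, s, t) j. let K = tm_symbols M in
    if q = 1 \<or> q = 2 then (if j = 0 then (0, q, 0, q) else (1, 0, 1, 0))
    else case tm_trans M q s of (q', s', d) \<Rightarrow>
      if j = 0 then (0, q, 0, q')
      else if j = 1 then (case d of Move_Left \<Rightarrow> (K, t, 1, 0) | Move_Right \<Rightarrow> (K, t, K * K, s' + K * t))
      else (case d of Move_Left \<Rightarrow> (K, s, K * K, t + K * s') | Move_Right \<Rightarrow> (K, s, 1, 0)))"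

definition tm_rule_list :: "(nat \<times> nat \<times> nat) list" where
  "tm_rule_list = List.product [0..<tm_states M] (List.product [0..<tm_symbols M] [0..<tm_symbols M])"

definition tm_rules :: rules where
  "tm_rules \<rho> = tm_rule (tm_rule_list ! \<rho>)"

definition regs :: "nat \<times> nat \<times> nat \<Rightarrow> nat \<Rightarrow> nat" where
  "regs = (\<lambda>(x, y, z) j. if j = 0 then x else if j = 1 then y else z)"

lemma all_less_3: "(\<forall>j<3. P j) \<longleftrightarrow> P 0 \<and> P 1 \<and> P (2 :: nat)"
  by (auto simp: numeral_3_eq_3 numeral_2_eq_2 less_Suc_eq)

lemma rstep_tm:
  assumes "r 0 < tm_states M"
  shows "rstep (length tm_rule_list) 3 tm_rules r r' \<longleftrightarrow> (r' 0, r' 1, r' 2) = nstep M (r 0, r 1, r 2)"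
proof -
  define K where "K = tm_symbols M"
  have K: "K > 0" using symbols_ge_3 by (simp add: K_def)
  define app where "app p r = (\<exists>y. \<forall>j<3. r j = fst (tm_rule p j) * y j + fst (snd (tm_rule p j)) \<and>
      r' j = fst (snd (snd (tm_rule p j))) * y j + snd (snd (snd (tm_rule p j))))" for p r
  have "rstep (length tm_rule_list) 3 tm_rules r r' \<longleftrightarrow> (\<exists>\<rho><length tm_rule_list. app (tm_rule_list ! \<rho>) r)"
    unfolding rstep_def al_def be_def ga_def de_def tm_rules_def app_def ..
  also have "\<dots> \<longleftrightarrow> (\<exists>p\<in>set tm_rule_list. app p r)"
    by (metis in_set_conv_nth)
  also have "\<dots> \<longleftrightarrow> (\<exists>q s t. q < tm_states M \<and> s < K \<and> t < K \<and> app (q, s, t) r)"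
    by (fastforce simp: tm_rule_list_def K_def)
  also have "\<dots> \<longleftrightarrow> (r' 0, r' 1, r' 2) = nstep M (r 0, r 1, r 2)"
  proof
    assume "\<exists>q s t. q < tm_states M \<and> s < K \<and> t < K \<and> app (q, s, t) r"
    then obtain q s t where *: "s < K" "t < K" "app (q, s, t) r" by blast
    then show "(r' 0, r' 1, r' 2) = nstep M (r 0, r 1, r 2)"
      unfolding app_def all_less_3
      by (auto simp: tm_rule_def Let_def K_def[symmetric] algebra_simps split: prod.splits move.splits if_splits)
  next
    assume *: "(r' 0, r' 1, r' 2) = nstep M (r 0, r 1, r 2)"
    \<comment> \<open>Quotients by K for an ordinary rule, whole registers for the identity rule of
      a halting state.\<close>
    define y where "y j = (if r 0 = 1 \<or> r 0 = 2 then r j else r j div K)" for j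
    have "K * (x mod K) + K * (K * (x div K)) = K * x" for x
      unfolding distrib_left[symmetric] by simp
    then have "app (r 0, r 2 mod K, r 1 mod K) r"
      using * unfolding app_def all_less_3
      by (intro exI[of _ y])
         (auto simp: tm_rule_def Let_def K_def[symmetric] y_def algebra_simps
            split: prod.splits move.splits if_splits)
    then show "\<exists>q s t. q < tm_states M \<and> s < K \<and> t < K \<and> app (q, s, t) r"
      using assms K by (meson mod_less_divisor)
  qed
  finally show ?thesis .
qed

lemma rrun_tm:
  assumes "r 0 < tm_states M"
  shows "rrun (length tm_rule_list) 3 tm_rules t r r' \<longleftrightarrow>
    (r' 0, r' 1, r' 2) = (nstep M ^^ t) (r 0, r 1, r 2)"
  using assms
proof (induction t arbitrary: r)
  case 0
  then show ?case by (auto simp: all_less_3)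
next
  case (Suc t)
  show ?case
  proof
    assume "rrun (length tm_rule_list) 3 tm_rules (Suc t) r r'"
    then obtain r1 where r1: "(r1 0, r1 1, r1 2) = nstep M (r 0, r 1, r 2)"
      and run: "rrun (length tm_rule_list) 3 tm_rules t r1 r'"
      using rstep_tm[of r] Suc.prems by auto
    have "r1 0 < tm_states M" using nstep_state[of "(r 0, r 1, r 2)"] r1 Suc.prems by (metis fst_conv)
    then show "(r' 0, r' 1, r' 2) = (nstep M ^^ Suc t) (r 0, r 1, r 2)"
      using Suc.IH[of r1] run r1 by (simp add: funpow_Suc_right del: funpow.simps nstep.simps)
  next
    assume *: "(r' 0, r' 1, r' 2) = (nstep M ^^ Suc t) (r 0, r 1, r 2)"
    define r1 where "r1 = regs (nstep M (r 0, r 1, r 2))"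
    have r1: "(r1 0, r1 1, r1 2) = nstep M (r 0, r 1, r 2)"
      by (simp add: r1_def regs_def split: prod.split)
    have "r1 0 < tm_states M" using nstep_state[of "(r 0, r 1, r 2)"] r1 Suc.prems by (metis fst_conv)
    then have "rrun (length tm_rule_list) 3 tm_rules t r1 r'"
      using Suc.IH[of r1] * r1 by (simp add: funpow_Suc_right del: funpow.simps nstep.simps)
    then show "rrun (length tm_rule_list) 3 tm_rules (Suc t) r r'"
      using rstep_tm[of r r1] Suc.prems r1 by auto
  qed
qed

definition rejects_num :: "nat \<Rightarrow> bool" where
  "rejects_num n \<longleftrightarrow> (\<exists>l r t. rrun (length tm_rule_list) 3 tm_rules t (regs (0, 0, n)) (regs (2, l, r)))"

lemma rejects_iff_num: "tm_rejects M w \<longleftrightarrow> rejects_num (push (tm_symbols M) w 0)"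
proof -
  have "rejects_num (push (tm_symbols M) w 0) \<longleftrightarrow>
      (\<exists>l r t. (2, l, r) = (nstep M ^^ t) (0, 0, push (tm_symbols M) w 0))"
    unfolding rejects_num_def using states_ge_3 by (subst rrun_tm) (simp_all add: regs_def)
  also have "\<dots> \<longleftrightarrow> (\<exists>t. fst ((nstep M ^^ t) (0, 0, push (tm_symbols M) w 0)) = 2)"
    by (metis fst_conv prod.collapse)
  finally show ?thesis by (simp add: rejects_iff_nstep)
qed

lemma dfun_regs:
  "dfun f \<Longrightarrow> dfun g \<Longrightarrow> dfun h \<Longrightarrow> dfun (\<lambda>v. regs (f v, g v, h v) j)"
  by (cases "j = 0"; cases "j = 1") (simp_all add: regs_def)

lemma dioph_rejects_num: "dfun f \<Longrightarrow> dioph (\<lambda>v. rejects_num (f v))"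
proof -
  have "dioph (\<lambda>v. rejects_num (v 0))"
    unfolding rejects_num_def by (intro dioph_intros dioph_reach dfun_regs)
  from dioph_subst[OF this, of "\<lambda>_. f"] show "dfun f \<Longrightarrow> dioph (\<lambda>v. rejects_num (f v))" by simp
qed

end

section \<open>Diophantine self-reference\<close>

text \<open>The leading 1 protects leading zeros, so words correspond to positive numbers.\<close>

definition code :: "bool list \<Rightarrow> nat" where
  "code ds = foldl (\<lambda>n d. 2 * n + of_bool d) 1 ds"

lemma code_Nil [simp]: "code [] = 1"
  and code_snoc [simp]: "code (ds @ [d]) = 2 * code ds + of_bool d"
  by (simp_all add: code_def)

lemma code_pos: "code ds \<ge> 1"
  by (induction ds rule: rev_induct) auto

lemma ex_code: "n \<ge> 1 \<Longrightarrow> \<exists>ds. n = code ds"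
proof (induction n rule: less_induct)
  case (less n)
  show ?case
  proof (cases "n = 1")
    case True
    then show ?thesis by (intro exI[of _ "[]"]) simp
  next
    case False
    then have "n div 2 < n" "1 \<le> n div 2" using less.prems by linarith+
    then obtain ds where "n div 2 = code ds" using less.IH by blast
    then have "n = code (ds @ [odd n])" by (cases "even n") (auto elim: oddE)
    then show ?thesis by blast
  qed
qed

lemma binary_code: "binary (code ds) = True # ds"
proof (induction ds rule: rev_induct)
  case Nil
  show ?case by (subst binary.simps, subst binary.simps) simp
next
  case (snoc d ds)
  then show ?case using code_pos[of ds] by (simp add: binary.simps[of "2 * code ds + of_bool d"])
qed

section \<open>Translation of numbers into words on the tape\<close>

context
  fixes K :: nat and g :: "bool \<Rightarrow> bool list"
begin

text \<open>Halving register 0 releases its digits from the last to the first, and each block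
  \<open>g d\<close> is put in front of the word in register 1, so the blocks end up in the right
  order. The index of the rule is the released digit.\<close>

definition conv_rules :: rules where
  "conv_rules \<rho> j = (if j = 0 then (2, \<rho>, 1, 0) else (1, 0, K ^ length (g (\<rho> = 1)), push K (g (\<rho> = 1)) 0))"

definition conv_regs :: "nat \<Rightarrow> nat \<Rightarrow> nat \<Rightarrow> nat" where
  "conv_regs x y j = (if j = 0 then x else y)"

definition converts :: "nat \<Rightarrow> nat \<Rightarrow> nat \<Rightarrow> bool" where
  "converts x n n' \<longleftrightarrow> (\<exists>t. rrun 2 2 conv_rules t (conv_regs x n) (conv_regs 1 n'))"

lemma rstep_conv:
  "rstep 2 2 conv_rules r r' \<longleftrightarrow> r' 0 = r 0 div 2 \<and> r' 1 = push K (g (odd (r 0))) (r 1)"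
proof -
  have less_2: "(\<forall>j<2. P j) \<longleftrightarrow> P 0 \<and> P 1" "(\<exists>j<2. P j) \<longleftrightarrow> P 0 \<or> P (1 :: nat)" for P
    by (auto simp: numeral_2_eq_2 less_Suc_eq)
  have "rstep 2 2 conv_rules r r' \<longleftrightarrow> (\<exists>\<rho><2. \<exists>y. r 0 = 2 * y 0 + \<rho> \<and> r' 0 = y 0 \<and> r 1 = y (1 :: nat) \<and>
      r' 1 = push K (g (\<rho> = 1)) (y 1))"
    unfolding rstep_def less_2(1) al_def be_def ga_def de_def conv_rules_def
    by (subst (3) push_affine) (simp add: conj_ac add.commute)
  also have "\<dots> \<longleftrightarrow> (\<exists>\<rho><2. r 0 = 2 * r' 0 + \<rho> \<and> r' 1 = push K (g (\<rho> = 1)) (r 1))"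
  proof (intro ex_cong1 conj_cong refl)
    fix \<rho>
    show "(\<exists>y. r 0 = 2 * y 0 + \<rho> \<and> r' 0 = y 0 \<and> r 1 = y (1 :: nat) \<and> r' 1 = push K (g (\<rho> = 1)) (y 1)) \<longleftrightarrow>
        r 0 = 2 * r' 0 + \<rho> \<and> r' 1 = push K (g (\<rho> = 1)) (r 1)"
      by (auto intro: exI[of _ "conv_regs (r' 0) (r 1)"] simp: conv_regs_def)
  qed
  also have "\<dots> \<longleftrightarrow> r' 0 = r 0 div 2 \<and> r' 1 = push K (g (odd (r 0))) (r 1)"
  proof -
    have *: "r 0 = 2 * r' 0 + 0 \<longleftrightarrow> even (r 0) \<and> r' 0 = r 0 div 2"
      "r 0 = 2 * r' 0 + 1 \<longleftrightarrow> odd (r 0) \<and> r' 0 = r 0 div 2" by presburger+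
    show ?thesis unfolding less_2(2) * by (cases "even (r 0)") simp_all
  qed
  finally show ?thesis .
qed

lemma rrun_conv_div: "rrun 2 2 conv_rules t r r' \<Longrightarrow> r' 0 = r 0 div 2 ^ t"
proof (induction t arbitrary: r)
  case (Suc t)
  then obtain r1 where "r1 0 = r 0 div 2" "rrun 2 2 conv_rules t r1 r'" by (auto simp: rstep_conv)
  then show ?case using Suc.IH by (simp add: div_mult2_eq)
qed simp

text \<open>The value 1 in register 0, the code of the empty word, marks the end. Halving it gives 0
  from then on, so 1 is met only once and the length of the run is determined.\<close>

lemma converts_code: "converts (code ds) n n' \<longleftrightarrow> n' = push K (concat (map g ds)) n"
proof (induction ds arbitrary: n rule: rev_induct)
  case Nil
  show ?case
  proof
    assume "converts (code []) n n'"
    then obtain t where t: "rrun 2 2 conv_rules t (conv_regs 1 n) (conv_regs 1 n')"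
      by (auto simp: converts_def)
    have "1 = 1 div (2::nat) ^ t" using rrun_conv_div[OF t] by (simp add: conv_regs_def)
    then have "t = 0" by (cases t) (simp_all add: div_mult2_eq)
    then show "n' = push K (concat (map g [])) n" using t by (auto simp: conv_regs_def dest: spec[of _ 1])
  next
    assume "n' = push K (concat (map g [])) n"
    then show "converts (code []) n n'" by (auto simp: converts_def intro: exI[of _ 0])
  qed
next
  case (snoc d ds)
  let ?n = "push K (g d) n"
  have "converts (code (ds @ [d])) n n' \<longleftrightarrow> converts (code ds) ?n n'"
  proof
    assume "converts (code (ds @ [d])) n n'"
    then obtain t where t: "rrun 2 2 conv_rules t (conv_regs (code (ds @ [d])) n) (conv_regs 1 n')"
      by (auto simp: converts_def)
    have "t \<noteq> 0"
    proof
      assume "t = 0"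
      then have "1 = code (ds @ [d])" using rrun_conv_div[OF t] by (simp only: conv_regs_def) simp
      then show False using code_pos[of ds] by simp
    qed
    then obtain t' where "t = Suc t'" by (cases t) auto
    then obtain r1 where r1: "r1 0 = code ds" "r1 1 = ?n" "rrun 2 2 conv_rules t' r1 (conv_regs 1 n')"
      using t by (auto simp: rstep_conv conv_regs_def)
    \<comment> \<open>Only registers 0 and 1 of \<open>r1\<close> are known, but a run depends on no
      others.\<close>
    have "rrun 2 2 conv_rules t' (conv_regs (code ds) ?n) (conv_regs 1 n')"
      using r1(3)
    proof (cases t')
      case 0
      then show ?thesis using r1 by (auto simp: conv_regs_def less_2_cases_iff)
    next
      case (Suc t'')
      then show ?thesis using r1 by (auto simp: rstep_conv conv_regs_def)
    qed
    then show "converts (code ds) ?n n'" by (auto simp: converts_def)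
  next
    assume "converts (code ds) ?n n'"
    then obtain t where t: "rrun 2 2 conv_rules t (conv_regs (code ds) ?n) (conv_regs 1 n')"
      by (auto simp: converts_def)
    have "rstep 2 2 conv_rules (conv_regs (code (ds @ [d])) n) (conv_regs (code ds) ?n)"
      by (simp add: rstep_conv conv_regs_def)
    then have "rrun 2 2 conv_rules (Suc t) (conv_regs (code (ds @ [d])) n) (conv_regs 1 n')"
      using t by auto
    then show "converts (code (ds @ [d])) n n'" unfolding converts_def by blast
  qed
  then show ?case using snoc.IH[of ?n] by (simp add: push_append)
qed

lemma dioph_converts:
  assumes "dfun f" "dfun h" "dfun k"
  shows "dioph (\<lambda>v. converts (f v) (h v) (k v))"
proof -
  have regs: "dfun f \<Longrightarrow> dfun h \<Longrightarrow> dfun (\<lambda>v. conv_regs (f v) (h v) j)" for f h j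
    by (cases "j = 0") (simp_all add: conv_regs_def)
  show ?thesis unfolding converts_def by (intro dioph_reach regs assms dioph_intros)
qed

end

lemma dfun_push: "dfun f \<Longrightarrow> dfun (\<lambda>v. push K w (f v))"
  by (subst push_affine) (intro dioph_intros)

section \<open>The self-referential predicate\<close>

context
  fixes M :: tm
  assumes M: "turing_machine M"
begin

text \<open>The prefix is the sign followed by the marked leading digit 1; the suffix ends the
  numerator and writes the denominator 1. What lies between is the same for both signs.\<close>

lemma enc_rat_code:
  "enc_rat (of_nat (code ds)) = [False, True, True] @ concat (map (\<lambda>d. [True, d]) ds) @ [False, True, True, False]"
  "enc_rat (- of_nat (code ds)) = [True, True, True] @ concat (map (\<lambda>d. [True, d]) ds) @ [False, True, True, False]"
proof -
  have 1: "quotient_of (of_nat (code ds)) = (int (code ds), 1)"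
    "quotient_of (- of_nat (code ds)) = (- int (code ds), 1)"
    using quotient_of_int[of "int (code ds)"] quotient_of_int[of "- int (code ds)"]
    by (simp_all add: rat_uminus_code)
  have 2: "enc_nat 1 = [True, True, False]" using binary_code[of "[]"] by (simp add: enc_nat_def)
  show "enc_rat (of_nat (code ds)) = [False, True, True] @ concat (map (\<lambda>d. [True, d]) ds) @ [False, True, True, False]"
    "enc_rat (- of_nat (code ds)) = [True, True, True] @ concat (map (\<lambda>d. [True, d]) ds) @ [False, True, True, False]"
    using code_pos[of ds] 2 unfolding enc_rat_def 1
    by (simp_all add: enc_int_def enc_nat_def binary_code)
qed

text \<open>
  The number \<open>n\<close> is decoded as a pair of codes of words \<open>P\<close> and
  \<open>S\<close>; the tape holding \<open>P\<close>, the codes of the rationals $n$ and $-n$,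
  and \<open>S\<close> is built from right to left.
\<close>

definition quine_rejects :: "nat \<Rightarrow> bool" where
  "quine_rejects n \<longleftrightarrow> (let K = tm_symbols M in
    \<exists>p s x1 x2 x3 x4. n = (p + s) * (p + s) + p \<and>
      converts K (\<lambda>d. [d]) s 0 x1 \<and>
      converts K (\<lambda>d. [True, d]) n (push K [False, True, True, False] x1) x2 \<and>
      converts K (\<lambda>d. [True, d]) n (push K [False, True, True, False, True, True, True] x2) x3 \<and>
      converts K (\<lambda>d. [d]) p (push K [False, True, True] x3) x4 \<and> rejects_num M x4)"

lemma dioph_quine_rejects: "dioph (\<lambda>v. quine_rejects (v 0))"
  unfolding quine_rejects_def Let_def
  by (intro dioph_intros dioph_converts dioph_rejects_num[OF M] dfun_push)

text \<open>A polynomial pairing: (p + s)^2 + p is less than (p + s + 1)^2, so p + s is its integer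
  square root.\<close>

lemma pair_inj:
  fixes p s p' s' :: nat
  assumes "(p + s) * (p + s) + p = (p' + s') * (p' + s') + p'"
  shows "p = p' \<and> s = s'"
proof -
  have lt: "(p + s) * (p + s) + p < (p' + s') * (p' + s') + p'" if "p + s < p' + s'" for p s p' s' :: nat
  proof -
    have "(p + s + 1) * (p + s + 1) \<le> (p' + s') * (p' + s')" using that by (intro mult_le_mono) auto
    moreover have "(p + s + 1) * (p + s + 1) = (p + s) * (p + s) + 2 * p + 2 * s + 1"
      by (simp add: algebra_simps)
    ultimately show ?thesis by linarith
  qed
  have "p + s = p' + s'" using lt[of p s p' s'] lt[of p' s' p s] assms by linarith
  then show ?thesis using assms by simp
qed

text \<open>The constant words pushed in \<open>quine_rejects\<close> are the fixed letters of
  \<open>enc_rat_code\<close>; the one of seven letters joins the end of the code of n to the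
  beginning of that of -n. By \<open>pair_inj\<close>, the decoded numbers are the codes of P and
  S.\<close>

lemma quine_rejects:
  assumes n: "n = (code P + code S) * (code P + code S) + code P"
  shows "quine_rejects n \<longleftrightarrow> tm_rejects M (P @ enc_rat (of_nat n) @ enc_rat (- of_nat n) @ S)"
proof -
  define K where "K = tm_symbols M"
  have "n \<ge> 1" using n code_pos[of P] by simp
  then obtain ds where ds: "n = code ds" using ex_code by blast
  have id: "concat (map (\<lambda>d. [d]) xs) = xs" for xs :: "bool list" by (induction xs) auto
  have "quine_rejects n \<longleftrightarrow> (\<exists>x1 x2 x3 x4.
      converts K (\<lambda>d. [d]) (code S) 0 x1 \<and>
      converts K (\<lambda>d. [True, d]) n (push K [False, True, True, False] x1) x2 \<and>
      converts K (\<lambda>d. [True, d]) n (push K [False, True, True, False, True, True, True] x2) x3 \<and>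
      converts K (\<lambda>d. [d]) (code P) (push K [False, True, True] x3) x4 \<and> rejects_num M x4)"
    unfolding quine_rejects_def Let_def K_def[symmetric] using n pair_inj by metis
  also have "\<dots> \<longleftrightarrow> rejects_num M (push K (P @ enc_rat (of_nat n) @ enc_rat (- of_nat n) @ S) 0)"
    unfolding ds converts_code id enc_rat_code
    by (simp add: push_append del: push.simps) (simp add: push_append)
  finally show ?thesis by (simp add: K_def rejects_iff_num[OF M])
qed

end

section \<open>Polynomial equations as instances of Static\<close>

type_synonym form = "(rat \<times> nat \<times> nat) list"

definition form_val :: "form \<Rightarrow> (nat \<Rightarrow> real) \<Rightarrow> (nat \<Rightarrow> real) \<Rightarrow> real" where
  "form_val ms f g = (\<Sum>(c, i, j)\<leftarrow>ms. of_rat c * f i * g j)"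

text \<open>Entries at the same position add up, as for the two summands of \<open>Add p p\<close>;
  row 2 of \<open>copy_row\<close> cancels to 0 in this way.\<close>

definition form_entry :: "form \<Rightarrow> nat \<Rightarrow> nat \<Rightarrow> rat" where
  "form_entry ms i j = (\<Sum>(c, i', j')\<leftarrow>ms. if i = i' \<and> j = j' then c else 0)"

definition form_within :: "nat \<Rightarrow> form \<Rightarrow> bool" where
  "form_within N ms \<longleftrightarrow> (\<forall>(c, i, j) \<in> set ms. i < N \<and> j < N)"

definition form_neg :: "form \<Rightarrow> form" where
  "form_neg = map (\<lambda>(c, i, j). (- c, i, j))"

lemma form_neg: "form_val (form_neg ms) f g = - form_val ms f g"
  "form_within N (form_neg ms) \<longleftrightarrow> form_within N ms"
  by (induction ms) (auto simp: form_val_def form_within_def form_neg_def of_rat_minus)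

lemma sum_form_entry:
  assumes "form_within N ms"
  shows "(\<Sum>i<N. \<Sum>j<N. of_rat (form_entry ms i j) * f i * g j) = form_val ms f g"
  using assms
proof (induction ms)
  case Nil
  then show ?case by (simp add: form_val_def form_entry_def)
next
  case (Cons m ms)
  obtain c i' j' where m: "m = (c, i', j')" by (cases m)
  have N: "i' < N" "j' < N" and ms: "form_within N ms"
    using Cons.prems by (auto simp: form_within_def m)
  have "(\<Sum>i<N. \<Sum>j<N. of_rat (form_entry (m # ms) i j) * f i * g j) =
     (\<Sum>i<N. \<Sum>j<N. (if i = i' then if j = j' then of_rat c * f i * g j else 0 else 0)) +
     (\<Sum>i<N. \<Sum>j<N. of_rat (form_entry ms i j) * f i * g j)"
    unfolding sum.distrib[symmetric]
    by (intro sum.cong) (auto simp: form_entry_def m of_rat_add algebra_simps)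
  also have "(\<Sum>i<N. \<Sum>j<N. (if i = i' then if j = j' then of_rat c * f i * g j else 0 else 0)) =
      of_rat c * f i' * g j'"
  proof -
    have "(\<Sum>j<N. (if i = i' then if j = j' then of_rat c * f i * g j else 0 else 0)) =
        (if i = i' then of_rat c * f i * g j' else 0)" for i
      using N by simp
    then show ?thesis using N by simp
  qed
  finally show ?case using Cons.IH[OF ms] by (simp add: form_val_def m)
qed

text \<open>
  Rows 0 and 1 of $B(x)$ force $x_0 u_0 = 1$, and the others force $x_0 u_i = x_i u_0$. As
  $A x \<le> a$ forces $x_0 = 1$ and $x_1 = n$, the only point of $\mathcal{U}_c(x)$ is $x$ itself.
\<close>

definition copy_row :: "nat \<Rightarrow> nat \<Rightarrow> form" where
  "copy_row N r = (if r = 0 then [(1, 0, 0)] else if r = 1 then [(-1, 0, 0)]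
     else if r < 2 + N then [(1, 0, r - 2), (-1, r - 2, 0)]
     else [(-1, 0, r - (2 + N)), (1, r - (2 + N), 0)])"

text \<open>Every form occurs with its negation because Static only bounds values above by 0. The
  number n enters through the first two entries of \<open>vec_a\<close> alone, so its two codes are
  adjacent in the encoding.\<close>

definition form_instance :: "nat \<Rightarrow> form list \<Rightarrow> nat \<Rightarrow> static_data" where
  "form_instance N fs n = \<lparr>
     dim_x = N, dim_u = N,
     vec_a = vec_of_list [of_nat n, - of_nat n, 1, -1],
     vec_b = vec (2 + 2 * N) (\<lambda>r. if r = 0 then 1 else if r = 1 then -1 else 0),
     mat_A = mat 4 N (\<lambda>(i, j). if j = (if i < 2 then 1 else 0) then if even i then 1 else -1 else 0),
     mats_B = map (\<lambda>k. mat (2 + 2 * N) N (\<lambda>(r, j). form_entry (copy_row N r) k j)) [0..<N],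
     mats_H = map (\<lambda>f. mat N N (\<lambda>(i, j). form_entry f i j)) (fs @ map form_neg fs) \<rparr>"

lemma static_instance_form_instance: "static_instance (form_instance N fs n)"
  by (auto simp: static_instance_def form_instance_def)

lemma B_of_form_instance:
  assumes "r < 2 + 2 * N" "2 \<le> N" "u \<in> carrier_vec N"
  shows "(B_of (form_instance N fs n) x *\<^sub>v u) $ r = form_val (copy_row N r) (($) x) (($) u)"
proof -
  let ?I = "form_instance N fs n"
  have "(B_of ?I x *\<^sub>v u) $ r = (\<Sum>j<N. (\<Sum>k<N. of_rat (mats_B ?I ! k $$ (r, j)) * x $ k) * u $ j)"
    using assms by (simp add: B_of_def form_instance_def scalar_prod_def atLeast0LessThan)
  also have "\<dots> = (\<Sum>j<N. \<Sum>k<N. of_rat (form_entry (copy_row N r) k j) * x $ k * u $ j)"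
    unfolding sum_distrib_right using assms by (intro sum.cong) (simp_all add: form_instance_def)
  also have "\<dots> = (\<Sum>k<N. \<Sum>j<N. of_rat (form_entry (copy_row N r) k j) * x $ k * u $ j)"
    by (rule sum.swap)
  also have "\<dots> = form_val (copy_row N r) (($) x) (($) u)"
    by (rule sum_form_entry) (use assms in \<open>auto simp: form_within_def copy_row_def\<close>)
  finally show ?thesis .
qed

lemma all_less_copy_rows:
  fixes N :: nat
  shows "(\<forall>r < 2 + 2 * N. P r) \<longleftrightarrow> P 0 \<and> P 1 \<and> (\<forall>i<N. P (2 + i) \<and> P (2 + N + i))"
proof
  assume *: "P 0 \<and> P 1 \<and> (\<forall>i<N. P (2 + i) \<and> P (2 + N + i))"
  show "\<forall>r < 2 + 2 * N. P r"
  proof (intro allI impI)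
    fix r :: nat assume "r < 2 + 2 * N"
    then consider "r = 0" | "r = 1" | i where "r = 2 + i" "i < N" | i where "r = 2 + N + i" "i < N"
      by (metis One_nat_def add_less_cancel_left le_Suc_ex less_2_cases mult_2 not_le add.assoc)
    then show "P r" using * by cases auto
  qed
qed auto

lemma U_c_form_instance:
  assumes N: "2 \<le> N" and x: "x \<in> carrier_vec N" "0\<^sub>v N \<le> x" "x $ 0 = 1"
  shows "U_c (form_instance N fs n) x = {x}"
proof -
  let ?I = "form_instance N fs n"
  have dim: "dim_u ?I = N" "dim_vec (vec_b ?I) = 2 + 2 * N" by (simp_all add: form_instance_def)
  have "B_of ?I x *\<^sub>v u \<le> real_vec (vec_b ?I) \<longleftrightarrow> u = x" if u: "u \<in> carrier_vec N" for u
  proof -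
    let ?L = "\<lambda>r. form_val (copy_row N r) (($) x) (($) u)"
    have "B_of ?I x *\<^sub>v u \<le> real_vec (vec_b ?I) \<longleftrightarrow>
        (\<forall>r < 2 + 2 * N. ?L r \<le> (if r = 0 then 1 else if r = 1 then -1 else 0))"
      using B_of_form_instance[OF _ N u] unfolding less_eq_vec_def
      by (auto simp: dim B_of_def form_instance_def of_rat_minus)
    \<comment> \<open>The rows form opposite pairs and hence equations, simplified by
      \<open>x $ 0 = 1\<close>.\<close>
    also have "\<dots> \<longleftrightarrow> u $ 0 = 1 \<and> (\<forall>i<N. u $ i = x $ i)"
      unfolding all_less_copy_rows using x(3)
      by (auto simp: form_val_def copy_row_def of_rat_minus intro: antisym)
    also have "\<dots> \<longleftrightarrow> u = x" using u x N by auto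
    finally show ?thesis .
  qed
  then show ?thesis using x unfolding U_c_def dim by auto
qed

lemma X_d_form_instance:
  assumes "2 \<le> N"
  shows "x \<in> X_d (form_instance N fs n) \<longleftrightarrow> x \<in> carrier_vec N \<and> 0\<^sub>v N \<le> x \<and>
    x $ 0 = 1 \<and> x $ 1 = real n \<and> (\<forall>i<N. x $ i \<in> \<int>)"
proof -
  let ?I = "form_instance N fs n"
  have dim: "dim_x ?I = N" "dim_row (mat_A ?I) = 4" by (simp_all add: form_instance_def)
  have "real_mat (mat_A ?I) *\<^sub>v x \<le> real_vec (vec_a ?I) \<longleftrightarrow> x $ 0 = 1 \<and> x $ 1 = real n"
    if x: "x \<in> carrier_vec N"
  proof -
    have row: "(real_mat (mat_A ?I) *\<^sub>v x) $ i = (\<Sum>j<N. of_rat (mat_A ?I $$ (i, j)) * x $ j)"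
      if "i < 4" for i
      using x that by (simp add: dim scalar_prod_def atLeast0LessThan form_instance_def)
    have delta: "(\<Sum>j<N. of_rat (if j = k then c else 0) * x $ j) = of_rat c * x $ k" if "k < N" for c k
    proof -
      have "(\<Sum>j<N. of_rat (if j = k then c else 0) * x $ j) =
          (\<Sum>j<N. if j = k then of_rat c * x $ j else 0)"
        by (intro sum.cong) simp_all
      then show ?thesis using that by simp
    qed
    have r: "(real_mat (mat_A ?I) *\<^sub>v x) $ 0 = x $ 1" "(real_mat (mat_A ?I) *\<^sub>v x) $ 1 = - x $ 1"
      "(real_mat (mat_A ?I) *\<^sub>v x) $ 2 = x $ 0" "(real_mat (mat_A ?I) *\<^sub>v x) $ 3 = - x $ 0"
      using assms delta[of 1 1] delta[of 1 "-1"] delta[of 0 1] delta[of 0 "-1"]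
      by (simp_all add: row) (simp_all add: form_instance_def of_rat_minus)
    have all4: "(\<forall>i<4. P i) \<longleftrightarrow> P 0 \<and> P 1 \<and> P 2 \<and> P (3 :: nat)" for P
      by (auto simp: numeral_eq_Suc less_Suc_eq)
    have a: "vec_a ?I $ 0 = of_nat n" "vec_a ?I $ 1 = - of_nat n" "vec_a ?I $ 2 = 1" "vec_a ?I $ 3 = -1"
      "dim_vec (vec_a ?I) = 4"
      by (simp_all add: form_instance_def numeral_2_eq_2 numeral_3_eq_3)
    have "real_mat (mat_A ?I) *\<^sub>v x \<le> real_vec (vec_a ?I) \<longleftrightarrow>
        (\<forall>i<4. (real_mat (mat_A ?I) *\<^sub>v x) $ i \<le> of_rat (vec_a ?I $ i))"
      unfolding less_eq_vec_def by (auto simp: dim a(5))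
    also have "\<dots> \<longleftrightarrow> x $ 0 = 1 \<and> x $ 1 = real n"
      unfolding all4 r a by (auto simp: of_rat_minus)
    finally show ?thesis .
  qed
  then show ?thesis unfolding X_d_def dim by auto
qed

text \<open>With x as the only admissible u, the bilinear conditions become quadratic equations in
  x, whose coordinates range over the natural numbers apart from the two prescribed ones.\<close>

lemma static_form_instance:
  assumes N: "2 \<le> N" and fs: "\<forall>f\<in>set fs. form_within N f"
  shows "static (form_instance N fs n) \<longleftrightarrow>
    (\<exists>\<xi> :: nat \<Rightarrow> nat. \<xi> 0 = 1 \<and> \<xi> 1 = n \<and> (\<forall>f\<in>set fs. form_val f (real \<circ> \<xi>) (real \<circ> \<xi>) = 0))"
proof -
  let ?I = "form_instance N fs n"
  have val: "form_val f g g = form_val f h h" if "form_within N f" "\<And>i. i < N \<Longrightarrow> g i = h i" for f g h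
    using that unfolding form_val_def form_within_def
    by (intro arg_cong[of _ _ sum_list] map_cong) auto
  have H: "x \<bullet> (real_mat (mat N N (\<lambda>(i, j). form_entry f i j)) *\<^sub>v x) = form_val f (($) x) (($) x)"
    if "x \<in> carrier_vec N" "form_within N f" for x f
    using that(1) unfolding sum_form_entry[OF that(2), symmetric]
    by (simp add: scalar_prod_def atLeast0LessThan sum_distrib_left algebra_simps)
  have Hs: "(\<forall>H \<in> set (mats_H ?I). x \<bullet> (real_mat H *\<^sub>v x) \<le> 0) \<longleftrightarrow>
      (\<forall>f\<in>set fs. form_val f (($) x) (($) x) = 0)" if x: "x \<in> carrier_vec N" for x
  proof -
    have "(\<forall>H \<in> set (mats_H ?I). x \<bullet> (real_mat H *\<^sub>v x) \<le> 0) \<longleftrightarrow>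
        (\<forall>f\<in>set fs. form_val f (($) x) (($) x) \<le> 0 \<and> form_val (form_neg f) (($) x) (($) x) \<le> 0)"
      using H[OF x] fs by (auto simp: form_instance_def ball_Un form_neg(2))
    then show ?thesis by (auto simp: form_neg intro: antisym)
  qed
  show ?thesis
  proof
    assume "static ?I"
    then obtain x where x: "x \<in> X_d ?I"
      and H: "\<forall>u \<in> U_c ?I x. \<forall>H \<in> set (mats_H ?I). u \<bullet> (real_mat H *\<^sub>v x) \<le> 0"
      unfolding static_def by blast
    from x have x': "x \<in> carrier_vec N" "0\<^sub>v N \<le> x" "x $ 0 = 1" "x $ 1 = real n" "\<forall>i<N. x $ i \<in> \<int>"
      by (simp_all add: X_d_form_instance[OF N])
    from H have *: "\<forall>f\<in>set fs. form_val f (($) x) (($) x) = 0"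
      using Hs[OF x'(1)] by (simp add: U_c_form_instance[OF N x'(1-3)])
    define \<xi> where "\<xi> i = nat \<lfloor>x $ i\<rfloor>" for i
    have \<xi>: "x $ i = (real \<circ> \<xi>) i" if "i < N" for i
    proof -
      have "x $ i \<ge> 0" using x'(1,2) that by (auto simp: less_eq_vec_def)
      then show ?thesis using x'(5) that by (auto simp: \<xi>_def elim!: Ints_cases)
    qed
    have "\<xi> 0 = 1" "\<xi> 1 = n" using x'(3,4) by (simp_all add: \<xi>_def)
    moreover have "\<forall>f\<in>set fs. form_val f (real \<circ> \<xi>) (real \<circ> \<xi>) = 0"
      using * val[of _ "($) x" "real \<circ> \<xi>"] fs \<xi> by auto
    ultimately show "\<exists>\<xi> :: nat \<Rightarrow> nat. \<xi> 0 = 1 \<and> \<xi> 1 = n \<and>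
        (\<forall>f\<in>set fs. form_val f (real \<circ> \<xi>) (real \<circ> \<xi>) = 0)" by blast
  next
    assume "\<exists>\<xi> :: nat \<Rightarrow> nat. \<xi> 0 = 1 \<and> \<xi> 1 = n \<and>
        (\<forall>f\<in>set fs. form_val f (real \<circ> \<xi>) (real \<circ> \<xi>) = 0)"
    then obtain \<xi> :: "nat \<Rightarrow> nat" where \<xi>: "\<xi> 0 = 1" "\<xi> 1 = n"
      "\<forall>f\<in>set fs. form_val f (real \<circ> \<xi>) (real \<circ> \<xi>) = 0" by blast
    define x where "x = vec N (real \<circ> \<xi>)"
    have x: "x \<in> carrier_vec N" "0\<^sub>v N \<le> x" "x $ 0 = 1" "x $ 1 = real n" "\<forall>i<N. x $ i \<in> \<int>"
      using N \<xi> by (auto simp: x_def less_eq_vec_def)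
    have "\<forall>f\<in>set fs. form_val f (($) x) (($) x) = 0"
      using \<xi>(3) val[of _ "($) x" "real \<circ> \<xi>"] fs by (auto simp: x_def)
    then have "\<forall>H \<in> set (mats_H ?I). x \<bullet> (real_mat H *\<^sub>v x) \<le> 0" using Hs[OF x(1)] by simp
    then show "static ?I" unfolding static_def
      using x by (intro bexI[of _ x]) (simp_all add: X_d_form_instance[OF N] U_c_form_instance[OF N])
  qed
qed

section \<open>Polynomial equations of any degree as quadratic forms\<close>

primrec subterms :: "dpoly \<Rightarrow> dpoly list" where
  "subterms (Par i) = [Par i]"
| "subterms (Aux i) = [Aux i]"
| "subterms (Num c) = [Num c]"
| "subterms (Add p q) = Add p q # subterms p @ subterms q"
| "subterms (Mul p q) = Mul p q # subterms p @ subterms q"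

lemma subterms_self: "p \<in> set (subterms p)"
  by (cases p) simp_all

lemma subterms_trans: "p \<in> set (subterms q) \<Longrightarrow> set (subterms p) \<subseteq> set (subterms q)"
  by (induction q) auto

definition eqs_terms :: "(dpoly \<times> dpoly) list \<Rightarrow> dpoly list" where
  "eqs_terms es = concat (map (\<lambda>(p, q). subterms p @ subterms q) es)"

lemma eqs_terms_closed:
  assumes "t \<in> set (eqs_terms es)" "s \<in> set (subterms t)"
  shows "s \<in> set (eqs_terms es)"
proof -
  obtain p q where pq: "(p, q) \<in> set es" "t \<in> set (subterms p) \<or> t \<in> set (subterms q)"
    using assms(1) by (auto simp: eqs_terms_def)
  then have "s \<in> set (subterms p) \<or> s \<in> set (subterms q)"
    using subterms_trans assms(2) by blast
  then show ?thesis using pq(1) by (auto simp: eqs_terms_def)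
qed

text \<open>Coordinates 0 and 1 hold the numbers 1 and $n$; every subterm has a coordinate for its value.\<close>

definition coord :: "dpoly list \<Rightarrow> dpoly \<Rightarrow> nat" where
  "coord ts t = 2 + length (takeWhile (\<lambda>s. s \<noteq> t) ts)"

lemma coord:
  assumes "t \<in> set ts"
  shows "coord ts t < 2 + length ts" "ts ! (coord ts t - 2) = t"
proof -
  have l: "length (takeWhile (\<lambda>s. s \<noteq> t) ts) < length ts"
    using assms by (induction ts) auto
  then show "coord ts t < 2 + length ts" by (simp add: coord_def)
  show "ts ! (coord ts t - 2) = t" using nth_length_takeWhile[OF l] by (simp add: coord_def)
qed

text \<open>Coordinate 0 has the value 1 and makes linear and constant terms quadratic. With a
  coordinate for each subterm, no operation needs more than one product of two coordinates. All
  parameters are tied to coordinate 1, and auxiliary unknowns stay free.\<close>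

fun term_form :: "dpoly list \<Rightarrow> dpoly \<Rightarrow> form" where
  "term_form ts (Par i) = [(1, 0, coord ts (Par i)), (-1, 0, 1)]"
| "term_form ts (Aux i) = []"
| "term_form ts (Num c) = [(1, 0, coord ts (Num c)), (- of_nat c, 0, 0)]"
| "term_form ts (Add p q) = [(1, 0, coord ts (Add p q)), (-1, 0, coord ts p), (-1, 0, coord ts q)]"
| "term_form ts (Mul p q) = [(1, 0, coord ts (Mul p q)), (-1, coord ts p, coord ts q)]"

definition eqs_forms :: "(dpoly \<times> dpoly) list \<Rightarrow> form list" where
  "eqs_forms es = (let ts = eqs_terms es in
     map (term_form ts) ts @ map (\<lambda>(p, q). [(1, 0, coord ts p), (-1, 0, coord ts q)]) es)"

definition eqs_instance :: "(dpoly \<times> dpoly) list \<Rightarrow> nat \<Rightarrow> static_data" where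
  "eqs_instance es = form_instance (2 + length (eqs_terms es)) (eqs_forms es)"

lemma subterms_mem:
  "Add p q \<in> set (eqs_terms es) \<Longrightarrow> p \<in> set (eqs_terms es) \<and> q \<in> set (eqs_terms es)"
  "Mul p q \<in> set (eqs_terms es) \<Longrightarrow> p \<in> set (eqs_terms es) \<and> q \<in> set (eqs_terms es)"
  "(p, q) \<in> set es \<Longrightarrow> p \<in> set (eqs_terms es) \<and> q \<in> set (eqs_terms es)"
proof -
  show "Add p q \<in> set (eqs_terms es) \<Longrightarrow> p \<in> set (eqs_terms es) \<and> q \<in> set (eqs_terms es)"
    by (auto intro: eqs_terms_closed[of "Add p q"] simp: subterms_self)
  show "Mul p q \<in> set (eqs_terms es) \<Longrightarrow> p \<in> set (eqs_terms es) \<and> q \<in> set (eqs_terms es)"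
    by (auto intro: eqs_terms_closed[of "Mul p q"] simp: subterms_self)
  show "(p, q) \<in> set es \<Longrightarrow> p \<in> set (eqs_terms es) \<and> q \<in> set (eqs_terms es)"
    using subterms_self by (force simp: eqs_terms_def)
qed

lemma form_within_term_form:
  assumes "t \<in> set (eqs_terms es)"
  shows "form_within (2 + length (eqs_terms es)) (term_form (eqs_terms es) t)"
proof (cases t)
  case (Add p q)
  then have "p \<in> set (eqs_terms es)" "q \<in> set (eqs_terms es)"
    using subterms_mem(1) assms by blast+
  then show ?thesis using coord(1)[OF assms] coord(1) by (simp add: form_within_def Add)
next
  case (Mul p q)
  then have "p \<in> set (eqs_terms es)" "q \<in> set (eqs_terms es)"
    using subterms_mem(2) assms by blast+
  then show ?thesis using coord(1)[OF assms] coord(1) by (simp add: form_within_def Mul)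
qed (use coord(1)[OF assms] in \<open>simp_all add: form_within_def\<close>)

lemma form_within_eqs_forms:
  "\<forall>f\<in>set (eqs_forms es). form_within (2 + length (eqs_terms es)) f"
proof
  fix f assume "f \<in> set (eqs_forms es)"
  then consider t where "t \<in> set (eqs_terms es)" "f = term_form (eqs_terms es) t"
    | p q where "(p, q) \<in> set es" "f = [(1, 0, coord (eqs_terms es) p), (-1, 0, coord (eqs_terms es) q)]"
    by (auto simp: eqs_forms_def Let_def)
  then show "form_within (2 + length (eqs_terms es)) f"
  proof cases
    case 1
    then show ?thesis by (simp only: form_within_term_form)
  next
    case 2
    then have "p \<in> set (eqs_terms es)" "q \<in> set (eqs_terms es)" using subterms_mem(3) by blast+
    from this[THEN coord(1)] show ?thesis by (simp add: form_within_def 2)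
  qed
qed

text \<open>By induction on terms the forms make every coordinate carry the value of its term;
  conversely these values satisfy the forms.\<close>

lemma static_eqs_instance:
  "static (eqs_instance es n) \<longleftrightarrow> (\<exists>w. sat es (\<lambda>_. n) w)"
proof -
  define ts where "ts = eqs_terms es"
  let ?v = "\<lambda>_ :: nat. n"
  have "static (eqs_instance es n) \<longleftrightarrow> (\<exists>\<xi> :: nat \<Rightarrow> nat. \<xi> 0 = 1 \<and> \<xi> 1 = n \<and>
      (\<forall>t\<in>set ts. form_val (term_form ts t) (real \<circ> \<xi>) (real \<circ> \<xi>) = 0) \<and>
      (\<forall>(p, q)\<in>set es. \<xi> (coord ts p) = \<xi> (coord ts q)))" (is "_ \<longleftrightarrow> (\<exists>\<xi>. ?P \<xi>)")
    unfolding eqs_instance_def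
    by (subst static_form_instance[OF _ form_within_eqs_forms])
       (auto simp: eqs_forms_def Let_def ts_def ball_Un form_val_def of_rat_minus split: prod.splits
          cong: conj_cong)
  also have "\<dots> \<longleftrightarrow> (\<exists>w. sat es ?v w)"
  proof
    assume "\<exists>\<xi>. ?P \<xi>"
    then obtain \<xi> where \<xi>: "?P \<xi>" by blast
    define w where "w i = \<xi> (coord ts (Aux i))" for i
    have "\<xi> (coord ts t) = dval t ?v w" if "t \<in> set ts" for t
      using that
    proof (induction t)
      case (Par i)
      then have "form_val (term_form ts (Par i)) (real \<circ> \<xi>) (real \<circ> \<xi>) = 0" using \<xi> by blast
      then show ?case using \<xi> by (simp add: form_val_def of_rat_minus)
    next
      case (Aux i)
      then show ?case by (simp add: w_def)
    next
      case (Num c)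
      then have "form_val (term_form ts (Num c)) (real \<circ> \<xi>) (real \<circ> \<xi>) = 0" using \<xi> by blast
      then show ?case using \<xi> by (simp add: form_val_def of_rat_minus)
    next
      case (Add p q)
      then have "form_val (term_form ts (Add p q)) (real \<circ> \<xi>) (real \<circ> \<xi>) = 0" using \<xi> by blast
      then have "real (\<xi> (coord ts (Add p q))) = real (\<xi> (coord ts p) + \<xi> (coord ts q))"
        using \<xi> by (simp add: form_val_def of_rat_minus)
      then show ?case using Add subterms_mem(1)[of p q es] by (simp only: of_nat_eq_iff) (simp add: ts_def)
    next
      case (Mul p q)
      then have "form_val (term_form ts (Mul p q)) (real \<circ> \<xi>) (real \<circ> \<xi>) = 0" using \<xi> by blast
      then have "real (\<xi> (coord ts (Mul p q))) = real (\<xi> (coord ts p) * \<xi> (coord ts q))"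
        using \<xi> by (simp add: form_val_def of_rat_minus)
      then show ?case using Mul subterms_mem(2)[of p q es] by (simp only: of_nat_eq_iff) (simp add: ts_def)
    qed
    note eval = this
    have "dval p ?v w = dval q ?v w" if pq: "(p, q) \<in> set es" for p q
    proof -
      have "p \<in> set ts" "q \<in> set ts" using subterms_mem(3) pq unfolding ts_def by blast+
      moreover have "\<xi> (coord ts p) = \<xi> (coord ts q)" using \<xi> pq by blast
      ultimately show ?thesis by (simp add: eval)
    qed
    then have "sat es ?v w" by (auto simp: sat_def)
    then show "\<exists>w. sat es ?v w" by blast
  next
    assume "\<exists>w. sat es ?v w"
    then obtain w where w: "sat es ?v w" by blast
    define \<xi> where "\<xi> i = (if i = 0 then 1 else if i = 1 then n else dval (ts ! (i - 2)) ?v w)" for i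
    have 01: "\<xi> 0 = 1" "\<xi> 1 = n" by (simp_all add: \<xi>_def)
    have c: "\<xi> (coord ts t) = dval t ?v w" if "t \<in> set ts" for t
      using coord(2)[OF that] by (simp add: \<xi>_def coord_def)
    have "form_val (term_form ts t) (real \<circ> \<xi>) (real \<circ> \<xi>) = 0" if t: "t \<in> set ts" for t
    proof (cases t)
      case (Add p q)
      then have "p \<in> set ts" "q \<in> set ts" using subterms_mem(1) t unfolding ts_def by blast+
      then show ?thesis using c[OF t] c 01 by (simp add: Add form_val_def of_rat_minus)
    next
      case (Mul p q)
      then have "p \<in> set ts" "q \<in> set ts" using subterms_mem(2) t unfolding ts_def by blast+
      then show ?thesis using c[OF t] c 01 by (simp add: Mul form_val_def of_rat_minus)
    qed (use c[OF t] 01 in \<open>simp_all add: form_val_def of_rat_minus\<close>)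
    moreover have "\<xi> (coord ts p) = \<xi> (coord ts q)" if pq: "(p, q) \<in> set es" for p q
    proof -
      have "p \<in> set ts" "q \<in> set ts" using subterms_mem(3) pq unfolding ts_def by blast+
      moreover have "dval p ?v w = dval q ?v w" using w pq by (auto simp: sat_def)
      ultimately show ?thesis by (simp add: c)
    qed
    ultimately show "\<exists>\<xi>. ?P \<xi>" using 01 by blast
  qed
  finally show ?thesis .
qed

text \<open>The dimensions do not depend on n, and the entries of \<open>vec_a\<close> are the first
  to be encoded after them.\<close>

lemma encode_eqs_instance:
  "\<exists>P S. \<forall>n. encode (eqs_instance es n) = P @ enc_rat (of_nat n) @ enc_rat (- of_nat n) @ S"
proof -
  let ?I = "eqs_instance es 0"
  have "encode (eqs_instance es n) =
    (enc_nat (dim_x ?I) @ enc_nat (dim_u ?I) @ enc_nat (dim_vec (vec_a ?I)) @ enc_nat (dim_vec (vec_b ?I)) @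
      enc_nat (length (mats_H ?I))) @
     enc_rat (of_nat n) @ enc_rat (- of_nat n) @ concat (map enc_rat ([1, -1] @ list_of_vec (vec_b ?I) @
       mat_entries (mat_A ?I) @ concat (map mat_entries (mats_B ?I)) @ concat (map mat_entries (mats_H ?I))))" for n
    by (simp add: encode_def static_entries_def eqs_instance_def form_instance_def list_vec)
  then show ?thesis by blast
qed

section \<open>The diagonal argument\<close>

lemma tm_halted:
  assumes "fst c = 1 \<or> fst c = 2"
  shows "(tm_step M ^^ t) c = c"
proof (induction t)
  case (Suc t)
  then show ?case using assms by (cases c) auto
qed simp

text \<open>Halted configurations are fixed by \<open>tm_step\<close>, so after s + t steps the
  state would be both 1 and 2.\<close>

lemma not_accepts_and_rejects: "\<not> (tm_accepts M w \<and> tm_rejects M w)"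
proof
  assume "tm_accepts M w \<and> tm_rejects M w"
  then obtain s t where s: "fst ((tm_step M ^^ s) (tm_init w)) = 1"
    and t: "fst ((tm_step M ^^ t) (tm_init w)) = 2"
    by (auto simp: tm_accepts_def tm_rejects_def)
  have "(tm_step M ^^ (t + s)) (tm_init w) = (tm_step M ^^ s) (tm_init w)"
    unfolding funpow_add comp_apply using s by (intro tm_halted) simp
  moreover have "(tm_step M ^^ (s + t)) (tm_init w) = (tm_step M ^^ t) (tm_init w)"
    unfolding funpow_add comp_apply using t by (intro tm_halted) simp
  ultimately show False using s t by (simp add: add.commute)
qed

theorem corollary2:
  shows "\<not> decidable static_language"
proof
  assume "decidable static_language"
  then obtain M where M: "turing_machine M"
    and acc: "\<And>w. w \<in> static_language \<Longrightarrow> tm_accepts M w"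
    and rej: "\<And>w. w \<notin> static_language \<Longrightarrow> tm_rejects M w"
    unfolding decidable_def by blast
  obtain es where es: "\<forall>v. quine_rejects M (v 0) \<longleftrightarrow> (\<exists>w. sat es v w)"
    using dioph_quine_rejects[OF M] unfolding dioph_def by blast
  obtain P S where enc:
    "\<And>n. encode (eqs_instance es n) = P @ enc_rat (of_nat n) @ enc_rat (- of_nat n) @ S"
    using encode_eqs_instance by blast
  \<comment> \<open>P and S come from \<open>es\<close> alone, which was fixed before n, so this
    choice is not circular.\<close>
  define n where "n = (code P + code S) * (code P + code S) + code P"
  let ?I = "eqs_instance es n"
  have "static ?I \<longleftrightarrow> quine_rejects M n"
    using es[rule_format, of "\<lambda>_. n"] by (simp add: static_eqs_instance)
  also have "\<dots> \<longleftrightarrow> tm_rejects M (encode ?I)"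
    unfolding enc by (rule quine_rejects[OF M n_def])
  finally have "static ?I \<longleftrightarrow> tm_rejects M (encode ?I)" .
  moreover have "encode ?I \<in> static_language \<longleftrightarrow> static ?I"
  proof -
    have I: "static_instance ?I"
      unfolding eqs_instance_def by (rule static_instance_form_instance)
    \<comment> \<open>Membership only provides some instance with this encoding; injectivity
      identifies it with \<open>?I\<close>.\<close>
    have "static J \<longleftrightarrow> static ?I" if "encode ?I = encode J" "static_instance J" for J
      using inj_onD[OF inj_on_encode that(1)] I that(2) by simp
    then show ?thesis using I unfolding static_language_def by blast
  qed
  ultimately show False
    using acc[of "encode ?I"] rej[of "encode ?I"] not_accepts_and_rejects by blast
qed

end
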